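(* Let $\mathbf{S}\in\mathcal{S}$ be normal continuous, self-contained and additive. Then $\mathbf{S}=\mathrm{Cov}$.
   Context: Let $(\Omega,\mathcal{F},\mathbb{P})$ be a probability space and let $\mathcal{D}(\mathbb{R})$ be a suitable, rich enough class of square integrable random variables $x:\Omega\to\mathbb{R}$ that contains the standard normal distribution. Assume that the product spaces $\mathcal{D}(\mathbb{R}^p)=\mathcal{D}(\mathbb{R})\times\cdots\times\mathcal{D}(\mathbb{R})$ are closed under affine transformations: $\mathbf{A}\mathbf{x}+\mathbf{b}\in\mathcal{D}(\mathbb{R}^p)$ for all $p\in\mathbb{N}$, $\mathbf{x}=(x_1,\ldots,x_p)^\top\in\mathcal{D}(\mathbb{R}^p)$, invertible $\mathbf{A}\in\mathbb{R}^{p\times p}$ and $\mathbf{b}\in\mathbb{R}^p$. Fix $p$, and assume also that $\mathcal{D}(\mathbb{R}^p)$ is closed under addition. Let $\mathbb{R}^{p\times p}_{++}$ be the space of all $p\times p$ positive-definite matrices. The ordinary covariance matrix is regarded as a functional $\mathrm{Cov}:\mathcal{D}(\mathbb{R}^p)\to\mathbb{R}^{p\times p}_{++}$. A functional $\mathbf{S}:\mathcal{D}(\mathbb{R}^p)\to\mathbb{R}^{p\times p}_{++}$ is a scatter functional if $\mathbf{S}(\mathbf{A}\mathbf{x}+\mathbf{b})=\mathbf{A}\mathbf{S}(\mathbf{x})\mathbf{A}^\top$ for all $\mathbf{x}\in\mathcal{D}(\mathbb{R}^p)$, invertible $\mathbf{A}\in\mathbb{R}^{p\times p}$ and $\mathbf{b}\in\mathbb{R}^p$.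 $\mathcal{S}$ denotes the class of precisely those scatter functionals that are standardized so that $\mathbf{S}(\mathbf{z})=\mathbf{I}_p$ for $\mathbf{z}\sim\mathcal{N}(\mathbf{0},\mathbf{I}_p)$; consequently $\mathbf{S}(\mathbf{x})=\boldsymbol{\Sigma}$ whenever $\mathbf{S}\in\mathcal{S}$ and $\mathbf{x}\sim\mathcal{N}(\mathbf{0},\boldsymbol{\Sigma})$. By location invariance one may assume without loss of generality that $\mathrm{E}(\mathbf{x})=\mathbf{0}$. A scatter functional $\mathbf{S}$ is additive if $\mathbf{S}(\mathbf{x}+\mathbf{y})=\mathbf{S}(\mathbf{x})+\mathbf{S}(\mathbf{y})$ for all pairs $\mathbf{x},\mathbf{y}\in\mathcal{D}(\mathbb{R}^p)$ such that $\mathbf{x}$ and $\mathbf{y}$ are independent. A scatter functional $\mathbf{S}\in\mathcal{S}$ is normal continuous if for any sequence of zero-mean random variables $\mathbf{x}_n\in\mathcal{D}(\mathbb{R}^p)$ converging in distribution to $\mathcal{N}(\mathbf{0},\boldsymbol{\Sigma})$ for $\boldsymbol{\Sigma}\in\mathbb{R}^{p\times p}_{++}$, we have $\mathbf{S}(\mathbf{x}_n)\to\boldsymbol{\Sigma}$ in some matrix norm $\|\cdot\|$. A scatter functional $\mathbf{S}\in\mathcal{S}$ is self-contained if $\mathbf{S}(\mathbf{x}_1)=\mathbf{S}(\mathbf{x}_2)$ for all pairs $\mathbf{x}_1,\mathbf{x}_2\in\mathcal{D}(\mathbb{R}^p)$ such that $\mathbf{x}_1$ and $\mathbf{x}_2$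 are identically distributed.
   Formalization: "Rich enough" is read as: any finite list of laws of members of D(R^p) is realized by independent members of D(R^p). Since D(R^p) contains 0, where S must vanish, S(x) is only required to be positive semidefinite, and positive definite when Cov(x) is. *)

theory Defs
  imports "HOL-Probability.Probability"
begin

section \<open>Matrices\<close>

definition positive_definite :: "real^'n^'n \<Rightarrow> bool" where
  "positive_definite A \<longleftrightarrow> transpose A = A \<and> (\<forall>v. v \<noteq> 0 \<longrightarrow> 0 < v \<bullet> (A *v v))"

definition positive_semidefinite :: "real^'n^'n \<Rightarrow> bool" where
  "positive_semidefinite A \<longleftrightarrow> transpose A = A \<and> (\<forall>v. 0 \<le> v \<bullet> (A *v v))"

text \<open>
  A square matrix of variable size \<open>p\<close> is a doubly indexed family of which only the
  entries with indices below \<open>p\<close> are relevant.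
\<close>

definition invertible_of_size :: "nat \<Rightarrow> (nat \<Rightarrow> nat \<Rightarrow> real) \<Rightarrow> bool" where
  "invertible_of_size p A \<longleftrightarrow>
     (\<exists>B. \<forall>i<p. \<forall>j<p. (\<Sum>k<p. A i k * B k j) = (if i = j then 1 else 0) \<and>
                        (\<Sum>k<p. B i k * A k j) = (if i = j then 1 else 0))"


section \<open>Classes of random variables\<close>

definition square_integrable_class :: "'a measure \<Rightarrow> ('a \<Rightarrow> real) set \<Rightarrow> bool" where
  "square_integrable_class M D \<longleftrightarrow>
     (\<forall>x\<in>D. x \<in> borel_measurable M \<and> integrable M (\<lambda>\<omega>. (x \<omega>)\<^sup>2))"

definition contains_std_normal :: "'a measure \<Rightarrow> ('a \<Rightarrow> real) set \<Rightarrow> bool" where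
  "contains_std_normal M D \<longleftrightarrow> (\<exists>z\<in>D. distr M borel z = std_normal_distribution)"

text \<open>The dimension \<open>p\<close> is quantified inside the formula, hence the indexing by \<open>nat\<close>.\<close>

definition closed_under_affine :: "('a \<Rightarrow> real) set \<Rightarrow> bool" where
  "closed_under_affine D \<longleftrightarrow>
     (\<forall>(p::nat) (x :: nat \<Rightarrow> 'a \<Rightarrow> real) A b.
        (\<forall>j<p. x j \<in> D) \<and> invertible_of_size p A \<longrightarrow>
        (\<forall>i<p. (\<lambda>\<omega>. (\<Sum>j<p. A i j * x j \<omega>) + b i) \<in> D))"

text \<open>The \<open>p\<close>-fold product of a class of random variables, where \<open>p = CARD('n)\<close>.\<close>

definition random_vectors :: "('a \<Rightarrow> real) set \<Rightarrow> ('a \<Rightarrow> real^'n) set" where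
  "random_vectors D = {x. \<forall>i. (\<lambda>\<omega>. x \<omega> $ i) \<in> D}"

definition closed_under_addition :: "('a \<Rightarrow> real^'n) set \<Rightarrow> bool" where
  "closed_under_addition V \<longleftrightarrow> (\<forall>x\<in>V. \<forall>y\<in>V. (\<lambda>\<omega>. x \<omega> + y \<omega>) \<in> V)"

text \<open>
  A class of random vectors is rich if any finite list of distributions that occur in it is also
  the list of distributions of independent members of it. In particular it contains \<open>n\<close>
  independent copies of each of its members, for every \<open>n\<close>.
\<close>

definition rich :: "'a measure \<Rightarrow> ('a \<Rightarrow> real^'n) set \<Rightarrow> bool" where
  "rich M V \<longleftrightarrow>
     (\<forall>(n::nat) x. (\<forall>k<n. x k \<in> V) \<longrightarrow>
        (\<exists>y. (\<forall>k<n. y k \<in> V \<and> distr M borel (y k) = distr M borel (x k)) \<and>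
             prob_space.indep_vars M (\<lambda>_. borel) y {..<n}))"


section \<open>Covariance and the multivariate normal distribution\<close>

definition covariance_matrix :: "'a measure \<Rightarrow> ('a \<Rightarrow> real^'n) \<Rightarrow> real^'n^'n" where
  "covariance_matrix M x =
     (\<chi> i j. \<integral>\<omega>. (x \<omega> $ i - (\<integral>\<xi>. x \<xi> $ i \<partial>M)) * (x \<omega> $ j - (\<integral>\<xi>. x \<xi> $ j \<partial>M)) \<partial>M)"

text \<open>Meaningful for positive definite \<open>\<Sigma>\<close> only.\<close>

definition centred_normal :: "real^'n^'n \<Rightarrow> (real^'n) measure" where
  "centred_normal \<Sigma> =
     density lborel (\<lambda>v. ennreal (exp (- (v \<bullet> (matrix_inv \<Sigma> *v v)) / 2) /
                                  sqrt ((2 * pi) ^ CARD('n) * det \<Sigma>)))"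

definition converges_in_distribution ::
    "'a measure \<Rightarrow> (nat \<Rightarrow> 'a \<Rightarrow> real^'n) \<Rightarrow> (real^'n) measure \<Rightarrow> bool" where
  "converges_in_distribution M x N \<longleftrightarrow>
     (\<forall>f :: real^'n \<Rightarrow> real. continuous_on UNIV f \<and> bounded (range f) \<longrightarrow>
        (\<lambda>n. \<integral>\<omega>. f (x n \<omega>) \<partial>M) \<longlonglongrightarrow> (\<integral>v. f v \<partial>N))"


section \<open>Scatter functionals\<close>

text \<open>
  Positive definiteness of \<open>S x\<close> is required where the covariance matrix of \<open>x\<close> is positive
  definite. It cannot be required at every \<open>x\<close>: if \<open>0 \<in> V\<close>, then equivariance under
  \<open>A = 2 I\<close> forces \<open>S 0 = 4 S 0\<close>, that is, \<open>S 0 = 0\<close>.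
\<close>

definition scatter_functional ::
    "'a measure \<Rightarrow> ('a \<Rightarrow> real^'n) set \<Rightarrow> (('a \<Rightarrow> real^'n) \<Rightarrow> real^'n^'n) \<Rightarrow> bool" where
  "scatter_functional M V S \<longleftrightarrow>
     (\<forall>x\<in>V. positive_semidefinite (S x)) \<and>
     (\<forall>x\<in>V. positive_definite (covariance_matrix M x) \<longrightarrow> positive_definite (S x)) \<and>
     (\<forall>x\<in>V. \<forall>A b. invertible A \<longrightarrow> S (\<lambda>\<omega>. A *v x \<omega> + b) = A ** S x ** transpose A)"

definition standardized_scatter_functionals ::
    "'a measure \<Rightarrow> ('a \<Rightarrow> real^'n) set \<Rightarrow> (('a \<Rightarrow> real^'n) \<Rightarrow> real^'n^'n) set" where
  "standardized_scatter_functionals M V =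
     {S. scatter_functional M V S \<and>
         (\<forall>z\<in>V. distr M borel z = centred_normal (mat 1) \<longrightarrow> S z = mat 1)}"

definition additive_functional ::
    "'a measure \<Rightarrow> ('a \<Rightarrow> real^'n) set \<Rightarrow> (('a \<Rightarrow> real^'n) \<Rightarrow> real^'n^'n) \<Rightarrow> bool" where
  "additive_functional M V S \<longleftrightarrow>
     (\<forall>x\<in>V. \<forall>y\<in>V. prob_space.indep_var M borel x borel y \<longrightarrow>
        S (\<lambda>\<omega>. x \<omega> + y \<omega>) = S x + S y)"

definition normal_continuous ::
    "'a measure \<Rightarrow> ('a \<Rightarrow> real^'n) set \<Rightarrow> (('a \<Rightarrow> real^'n) \<Rightarrow> real^'n^'n) \<Rightarrow> bool" where
  "normal_continuous M V S \<longleftrightarrow>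
     (\<forall>\<Sigma> x. positive_definite \<Sigma> \<and> (\<forall>n. x n \<in> V \<and> (\<integral>\<omega>. x n \<omega> \<partial>M) = 0) \<and>
        converges_in_distribution M x (centred_normal \<Sigma>) \<longrightarrow>
        (\<lambda>n. S (x n)) \<longlonglongrightarrow> \<Sigma>)"

definition self_contained ::
    "'a measure \<Rightarrow> ('a \<Rightarrow> real^'n) set \<Rightarrow> (('a \<Rightarrow> real^'n) \<Rightarrow> real^'n^'n) \<Rightarrow> bool" where
  "self_contained M V S \<longleftrightarrow>
     (\<forall>x\<in>V. \<forall>y\<in>V. distr M borel x = distr M borel y \<longrightarrow> S x = S y)"

end

theory Submission
  imports Defs
begin

text \<open>
  The functional \<open>S\<close> does not change along the central limit theorem. If \<open>x\<^sub>1, \<dots>, x\<^sub>n\<close> are independent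
  copies of a centred vector \<open>x\<close>, then self-containedness and additivity give
  \<open>S (x\<^sub>1 + \<dots> + x\<^sub>n) = n S x\<close>, and equivariance under the scaling by \<open>1 / sqrt n\<close> brings this back to
  \<open>S x\<close>. The normalised sums tend to a normal vector with the covariance matrix of \<open>x\<close>, and normal
  continuity identifies \<open>S x\<close> with this matrix.

  Convergence in distribution of random vectors is the analytic part. An independent standard normal
  vector \<open>W\<close> is added to each normalised sum \<open>X\<^sub>n\<close>, which only adds the identity matrix to \<open>S\<close>. The vector
  \<open>X\<^sub>n + W\<close> has a density, given by an explicit Fourier integral over the characteristic function of \<open>X\<^sub>n\<close>
  (\<open>smoothed_density_eq_vchar\<close>). Hence convergence of the characteristic functions
  (\<open>vchar_power_tendsto\<close>) makes the densities converge pointwise, and by Scheffe's lemma in the mean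
  (\<open>smoothed_expectation_tendsto\<close>).

  The limit has to be computed only for vectors with the identity as covariance matrix, where it is the
  centred normal with covariance matrix \<open>mat 2\<close> (\<open>smoothed_density_gauss\<close>, \<open>S_eq_mat_1\<close>). A positive definite
  covariance matrix is reduced to the identity by whitening (\<open>whitening_matrix_exists\<close>), and an
  arbitrary one is made positive definite by adding an independent standard normal vector, on which
  \<open>S\<close> and the covariance matrix agree (\<open>S_eq_covariance\<close>).
\<close>

section \<open>The standard normal distribution on a Euclidean space\<close>

definition gauss_density :: "'v::euclidean_space \<Rightarrow> real" where
  "gauss_density v = exp (- (v \<bullet> v) / 2) / sqrt ((2 * pi) ^ DIM('v))"

definition gauss :: "'v::euclidean_space measure" where
  "gauss = density lborel gauss_density"

text \<open>
  The characteristic function of a distribution on a Euclidean space, extending \<open>char\<close> from the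
  real line.
\<close>

definition vchar :: "'v::euclidean_space measure \<Rightarrow> 'v \<Rightarrow> complex" where
  "vchar \<mu> t = (\<integral>x. iexp (t \<bullet> x) \<partial>\<mu>)"

lemma gauss_density_pos: "0 < gauss_density v"
  by (simp add: gauss_density_def)

lemma gauss_density_nonneg [simp]: "0 \<le> gauss_density v"
  using gauss_density_pos[of v] by simp

lemma borel_measurable_gauss_density [measurable]:
  "(gauss_density :: 'v::euclidean_space \<Rightarrow> real) \<in> borel_measurable borel"
  unfolding gauss_density_def[abs_def] by measurable

lemma sets_gauss [simp, measurable_cong]: "sets gauss = sets borel"
  by (simp add: gauss_def)

lemma space_gauss [simp]: "space gauss = UNIV"
  by (simp add: gauss_def)

lemma gauss_density_eq_prod:
  "gauss_density (v::'v::euclidean_space) = (\<Prod>b\<in>Basis. std_normal_density (v \<bullet> b))"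
proof -
  have *: "(\<Sum>b\<in>Basis. - (v \<bullet> b)\<^sup>2 / 2) = - (v \<bullet> v) / 2"
    by (simp add: euclidean_inner[of v v] power2_eq_square sum_divide_distrib sum_negf)
  have "(\<Prod>b\<in>(Basis::'v set). std_normal_density (v \<bullet> b)) =
      (\<Prod>b\<in>(Basis::'v set). 1 / sqrt (2 * pi)) * (\<Prod>b\<in>(Basis::'v set). exp (- (v \<bullet> b)\<^sup>2 / 2))"
    by (simp only: std_normal_density_def prod.distrib)
  also have "(\<Prod>b\<in>(Basis::'v set). 1 / sqrt (2 * pi)) = 1 / sqrt ((2 * pi) ^ DIM('v))"
    by (simp add: power_divide real_sqrt_power[symmetric] del: real_sqrt_mult)
  also have "(\<Prod>b\<in>(Basis::'v set). exp (- (v \<bullet> b)\<^sup>2 / 2)) = exp (- (v \<bullet> v) / 2)"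
    unfolding *[symmetric] by (rule exp_sum[OF finite_Basis, symmetric])
  finally show ?thesis
    by (simp add: gauss_density_def)
qed

lemma emeasure_gauss_box:
  fixes l u :: "'v::euclidean_space"
  shows "emeasure gauss (box l u) =
    (\<Prod>b\<in>Basis. emeasure std_normal_distribution {l \<bullet> b <..< u \<bullet> b})"
proof -
  let ?h = "\<lambda>b x. std_normal_density x * indicator {l \<bullet> b <..< u \<bullet> b} x :: real"
  have "emeasure gauss (box l u) = (\<integral>\<^sup>+v. gauss_density v * indicator (box l u) v \<partial>lborel)"
    by (simp add: gauss_def emeasure_density ennreal_mult' ennreal_indicator)
  also have "\<dots> = (\<integral>\<^sup>+v. (\<Prod>b\<in>Basis. ennreal (?h b (v \<bullet> b))) \<partial>lborel)"
  proof (rule nn_integral_cong)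
    fix v :: 'v
    have "gauss_density v * indicator (box l u) v = (\<Prod>b\<in>Basis. ?h b (v \<bullet> b))"
    proof (cases "v \<in> box l u")
      case True
      then show ?thesis
        by (auto simp: gauss_density_eq_prod box_def intro!: prod.cong)
    next
      case False
      then obtain b where "b \<in> Basis" "v \<bullet> b \<notin> {l \<bullet> b <..< u \<bullet> b}"
        by (auto simp: box_def)
      then have "(\<Prod>b\<in>Basis. ?h b (v \<bullet> b)) = 0"
        by (intro prod_zero bexI[of _ b]) auto
      with False show ?thesis by simp
    qed
    then show "ennreal (gauss_density v * indicator (box l u) v)
        = (\<Prod>b\<in>Basis. ennreal (?h b (v \<bullet> b)))"
      by (simp add: prod_ennreal)
  qed
  also have "\<dots> = (\<Prod>b\<in>Basis. \<integral>\<^sup>+x. ennreal (?h b x) \<partial>lborel)"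
    by (rule nn_integral_lborel_prod) auto
  also have "\<dots> = (\<Prod>b\<in>Basis. emeasure std_normal_distribution {l \<bullet> b <..< u \<bullet> b})"
    by (simp add: emeasure_density ennreal_mult' ennreal_indicator)
  finally show ?thesis .
qed

text \<open>
  Both sides are finite and agree on boxes, which generate the Borel sets. This is the bridge from
  independent one-dimensional normal variables to a density with respect to \<open>lborel\<close>; the
  characteristic function below is read off on the product side.
\<close>

lemma distr_PiM_std_normal:
  "distr (\<Pi>\<^sub>M b\<in>(Basis::'v::euclidean_space set). std_normal_distribution) borel
     (\<lambda>f. \<Sum>b\<in>Basis. f b *\<^sub>R b) = (gauss :: 'v measure)" (is "?D = _")
proof (rule measure_eqI_generator_eq)
  interpret std: prob_space std_normal_distribution
    by (rule prob_space_normal_density) simp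
  interpret product_prob_space "\<lambda>_. std_normal_distribution" "Basis :: 'v set" ..
  let ?E = "range (\<lambda>(a, b). box a b :: 'v set)"
  let ?A = "\<lambda>n::nat. box (- (real n *\<^sub>R One)) (real n *\<^sub>R One) :: 'v set"
  have meas [measurable]: "(\<lambda>f. \<Sum>b\<in>Basis. f b *\<^sub>R b) \<in>
      (\<Pi>\<^sub>M b\<in>(Basis::'v set). std_normal_distribution) \<rightarrow>\<^sub>M borel"
    by measurable
  show "Int_stable ?E"
    by (auto simp: Int_stable_def box_Int_box)
  show "?E \<subseteq> Pow UNIV" "sets ?D = sigma_sets UNIV ?E"
      "sets (gauss :: 'v measure) = sigma_sets UNIV ?E"
    by (simp_all add: borel_eq_box)
  show "range ?A \<subseteq> ?E" "(\<Union>i. ?A i) = UNIV"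
    unfolding UN_box_eq_UNIV by auto
  have PD: "prob_space ?D"
    by (rule prob_space_distr[OF meas])
  show "emeasure ?D (?A i) \<noteq> \<infinity>" for i
    using finite_measure.emeasure_finite[OF prob_space.finite_measure[OF PD]] by (simp add: top_unique)
  show "emeasure ?D X = emeasure gauss X" if "X \<in> ?E" for X
  proof -
    from that obtain l u where X: "X = box l u" by auto
    have "emeasure ?D X = emeasure (\<Pi>\<^sub>M b\<in>(Basis::'v set). std_normal_distribution)
        (\<Pi>\<^sub>E b\<in>Basis. {l \<bullet> b <..< u \<bullet> b})"
      unfolding X
      by (subst emeasure_distr[OF meas])
         (auto intro!: arg_cong2[where f=emeasure] simp: space_PiM box_def PiE_iff extensional_def)
    also have "\<dots> = (\<Prod>b\<in>Basis. emeasure std_normal_distribution {l \<bullet> b <..< u \<bullet> b})"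
      by (rule emeasure_PiM) auto
    finally show ?thesis
      by (simp add: X emeasure_gauss_box)
  qed
qed

lemma prob_space_gauss: "prob_space (gauss :: 'v::euclidean_space measure)"
proof -
  interpret std: prob_space std_normal_distribution
    by (rule prob_space_normal_density) simp
  interpret product_prob_space "\<lambda>_. std_normal_distribution" "Basis :: 'v set" ..
  show ?thesis
    unfolding distr_PiM_std_normal[symmetric] by (rule prob_space_distr) measurable
qed

lemma integrable_gauss_density: "integrable lborel (gauss_density :: 'v::euclidean_space \<Rightarrow> real)"
  and integral_gauss_density: "(\<integral>v. gauss_density (v::'v) \<partial>lborel) = 1"
proof -
  have "(\<integral>\<^sup>+v. gauss_density (v::'v) \<partial>lborel) = 1"
    using prob_space.emeasure_space_1[OF prob_space_gauss[where 'v='v]]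
    by (simp add: gauss_def emeasure_density)
  then show "integrable lborel (gauss_density :: 'v::euclidean_space \<Rightarrow> real)"
    "(\<integral>v. gauss_density (v::'v) \<partial>lborel) = 1"
    using nn_integral_eq_integrable[of gauss_density "lborel :: 'v measure" 1] by auto
qed

lemma iexp_sum: "finite A \<Longrightarrow> iexp (\<Sum>a\<in>A. f a) = (\<Prod>a\<in>A. iexp (f a))"
  by (simp add: exp_sum sum_distrib_left)

lemma vchar_gauss: "vchar gauss (t::'v::euclidean_space) = exp (- (t \<bullet> t) / 2)"
proof -
  interpret std: prob_space std_normal_distribution
    by (rule prob_space_normal_density) simp
  interpret product_prob_space "\<lambda>_. std_normal_distribution" "Basis :: 'v set" ..
  have "vchar gauss t = (\<integral>f. iexp (t \<bullet> (\<Sum>b\<in>Basis. f b *\<^sub>R b))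
      \<partial>(\<Pi>\<^sub>M b\<in>(Basis::'v set). std_normal_distribution))"
    unfolding vchar_def distr_PiM_std_normal[symmetric] by (subst integral_distr) auto
  also have "\<dots> = (\<integral>f. (\<Prod>b\<in>Basis. iexp ((t \<bullet> b) * f b))
      \<partial>(\<Pi>\<^sub>M b\<in>(Basis::'v set). std_normal_distribution))"
    by (simp only: inner_sum_right inner_scaleR_right iexp_sum[OF finite_Basis] mult.commute)
  also have "\<dots> = (\<Prod>b\<in>Basis. char std_normal_distribution (t \<bullet> b))"
    unfolding char_def
    by (rule product_integral_prod) (auto intro!: std.integrable_iexp simp del: of_real_mult)
  also have "\<dots> = (\<Prod>b\<in>Basis. complex_of_real (exp (- (t \<bullet> b)\<^sup>2 / 2)))"
    by (simp add: char_std_normal_distribution)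
  also have "\<dots> = complex_of_real (exp (\<Sum>b\<in>Basis. - (t \<bullet> b)\<^sup>2 / 2))"
    by (simp only: exp_sum[OF finite_Basis] of_real_prod)
  also have "(\<Sum>b\<in>Basis. - (t \<bullet> b)\<^sup>2 / 2) = - (t \<bullet> t) / 2"
    by (simp add: euclidean_inner[of t t] power2_eq_square sum_divide_distrib sum_negf)
  finally show ?thesis .
qed

section \<open>Gaussian smoothing\<close>

text \<open>
  The Lebesgue density of \<open>X + W\<close>, where \<open>X\<close> has distribution \<open>\<mu>\<close> and \<open>W\<close> is standard normal and
  independent of \<open>X\<close>: the convolution of \<open>\<mu>\<close> with the Gaussian density. Lemma
  \<open>integral_gauss_translates\<close> below justifies this reading.
\<close>

definition smoothed_density :: "'v::euclidean_space measure \<Rightarrow> 'v \<Rightarrow> real" where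
  "smoothed_density \<mu> y = (\<integral>x. gauss_density (y - x) \<partial>\<mu>)"

lemma lborel_integral_translate:
  fixes f :: "'v::euclidean_space \<Rightarrow> 'b::{banach, second_countable_topology}"
  assumes [measurable]: "f \<in> borel_measurable borel"
  shows "(\<integral>u. f (c + u) \<partial>lborel) = (\<integral>y. f y \<partial>lborel)"
  by (subst (2) lborel_distr_plus[symmetric, of c]) (simp add: integral_distr)

lemma lborel_integrable_translate:
  fixes f :: "'v::euclidean_space \<Rightarrow> 'b::{banach, second_countable_topology}"
  assumes [measurable]: "f \<in> borel_measurable borel"
  shows "integrable lborel (\<lambda>u. f (c + u)) \<longleftrightarrow> integrable lborel f"
  by (subst (2) lborel_distr_plus[symmetric, of c]) (simp add: integrable_distr_eq)

lemma lborel_integral_affine: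
  fixes f :: "'v::euclidean_space \<Rightarrow> real"
  assumes [measurable]: "f \<in> borel_measurable borel" and c: "c \<noteq> 0"
  shows "(\<integral>x. f x \<partial>lborel) = (\<integral>u. \<bar>c\<bar> ^ DIM('v) * f (t + c *\<^sub>R u) \<partial>lborel)"
proof -
  have "(\<integral>x. f x \<partial>lborel) =
      (\<integral>x. f x \<partial>density (distr lborel borel (\<lambda>x. t + c *\<^sub>R x)) (\<lambda>_. ennreal (\<bar>c\<bar> ^ DIM('v))))"
    by (subst (1) lborel_affine[OF c, of t]) (simp only: ennreal_power[OF abs_ge_zero])
  also have "\<dots> = (\<integral>x. \<bar>c\<bar> ^ DIM('v) * f x \<partial>distr lborel borel (\<lambda>x. t + c *\<^sub>R x))"
    by (subst integral_density) auto
  also have "\<dots> = (\<integral>u. \<bar>c\<bar> ^ DIM('v) * f (t + c *\<^sub>R u) \<partial>lborel)"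
    by (subst integral_distr) auto
  finally show ?thesis .
qed

lemma integrable_gauss_density_diff:
  "integrable lborel (\<lambda>y. gauss_density (y - x :: 'v::euclidean_space))"
  using lborel_integrable_translate[of gauss_density "- x"] integrable_gauss_density
  by simp

lemma integral_gauss_density_diff:
  "(\<integral>y. gauss_density (y - x :: 'v::euclidean_space) \<partial>lborel) = 1"
  using lborel_integral_translate[of gauss_density "- x"] integral_gauss_density
  by simp

locale borel_prob_space = prob_space \<mu> for \<mu> :: "'v::euclidean_space measure" +
  assumes sets_eq_borel [simp, measurable_cong]: "sets \<mu> = sets borel"
begin

lemma smoothed_density_nonneg [simp]: "0 \<le> smoothed_density \<mu> y"
  by (simp add: smoothed_density_def)

lemma borel_measurable_smoothed_density [measurable]:
  "smoothed_density \<mu> \<in> borel_measurable borel"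
  unfolding smoothed_density_def[abs_def] by measurable

lemma borel_measurable_vchar [measurable]: "vchar \<mu> \<in> borel_measurable borel"
  unfolding vchar_def[abs_def] by measurable

lemma norm_vchar_le_1: "norm (vchar \<mu> t) \<le> 1"
proof -
  have "norm (vchar \<mu> t) \<le> (\<integral>x. norm (iexp (t \<bullet> x)) \<partial>\<mu>)"
    unfolding vchar_def by (rule integral_norm_bound)
  then show ?thesis
    by (simp add: prob_space)
qed

text \<open>
  Fourier inversion for the smoothed density. Up to a constant the Gaussian density is its own
  characteristic function, so \<open>gauss_density (y - x)\<close> is an integral of \<open>iexp ((y - x) \<bullet> t)\<close> against
  \<open>gauss\<close>; exchanging the order of integration collects the \<open>x\<close>-dependence in \<open>vchar \<mu> (- t)\<close>.
  Since \<open>gauss\<close> is a probability measure, all integrands are bounded and integrable.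
\<close>

lemma smoothed_density_eq_vchar:
  "complex_of_real (smoothed_density \<mu> y) =
     of_real (1 / sqrt ((2 * pi) ^ DIM('v))) * (\<integral>t. iexp (y \<bullet> t) * vchar \<mu> (- t) \<partial>gauss)"
proof -
  let ?c = "complex_of_real (1 / sqrt ((2 * pi) ^ DIM('v)))"
  interpret \<gamma>: prob_space "gauss :: 'v measure" by (rule prob_space_gauss)
  interpret P: pair_prob_space \<mu> "gauss :: 'v measure" ..
  have int: "integrable (\<mu> \<Otimes>\<^sub>M gauss) (\<lambda>(x, t). iexp ((y - x) \<bullet> t))"
    by (rule P.integrable_const_bound[where B=1]) (auto simp: split_beta)
  have "complex_of_real (smoothed_density \<mu> y) = (\<integral>x. ?c * vchar gauss (y - x) \<partial>\<mu>)"
    unfolding smoothed_density_def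
    by (simp add: integral_complex_of_real[symmetric] vchar_gauss gauss_density_def del: integral_complex_of_real)
  also have "\<dots> = ?c * (\<integral>x. (\<integral>t. iexp ((y - x) \<bullet> t) \<partial>gauss) \<partial>\<mu>)"
    by (simp add: vchar_def)
  also have "(\<integral>x. (\<integral>t. iexp ((y - x) \<bullet> t) \<partial>gauss) \<partial>\<mu>) = (\<integral>t. (\<integral>x. iexp ((y - x) \<bullet> t) \<partial>\<mu>) \<partial>gauss)"
    using P.Fubini_integral[OF int] by simp
  also have "\<dots> = (\<integral>t. iexp (y \<bullet> t) * vchar \<mu> (- t) \<partial>gauss)"
  proof (rule Bochner_Integration.integral_cong[OF refl])
    fix t
    have "(\<integral>x. iexp ((y - x) \<bullet> t) \<partial>\<mu>) = (\<integral>x. iexp (y \<bullet> t) * iexp ((- t) \<bullet> x) \<partial>\<mu>)"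
      by (simp add: inner_diff_left inner_commute exp_add[symmetric] algebra_simps)
    also have "\<dots> = iexp (y \<bullet> t) * vchar \<mu> (- t)"
      unfolding vchar_def by (rule integral_mult_right_zero)
    finally show "(\<integral>x. iexp ((y - x) \<bullet> t) \<partial>\<mu>) = iexp (y \<bullet> t) * vchar \<mu> (- t)" .
  qed
  finally show ?thesis .
qed

text \<open>
  Translating the inner integral by \<open>x\<close> moves the dependence on \<open>x\<close> from the test function to the
  Gaussian density, which Fubini's theorem then averages over \<open>\<mu>\<close>.
\<close>

lemma
  fixes f :: "'v \<Rightarrow> real"
  assumes [measurable]: "f \<in> borel_measurable borel" and B: "\<And>v. \<bar>f v\<bar> \<le> B"
  shows integral_gauss_translates:
      "(\<integral>x. (\<integral>u. f (x + u) \<partial>gauss) \<partial>\<mu>) = (\<integral>y. f y * smoothed_density \<mu> y \<partial>lborel)"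
    and integrable_smoothed_density_mult: "integrable lborel (\<lambda>y. f y * smoothed_density \<mu> y)"
proof -
  interpret P: pair_sigma_finite \<mu> "lborel :: 'v measure" ..
  have bound: "norm (f y * gauss_density (y - x)) \<le> norm (B * gauss_density (y - x))" for x y
    using B[of y] by (auto simp: abs_mult intro!: mult_right_mono)
  have int1: "integrable lborel (\<lambda>y. f y * gauss_density (y - x))" for x
    by (rule Bochner_Integration.integrable_bound[OF
          integrable_mult_right[OF integrable_gauss_density_diff[of x], of B]])
       (use bound in auto)
  have int2: "integrable lborel (\<lambda>y. \<bar>f y\<bar> * gauss_density (y - x))" for x
    using integrable_norm[OF int1[of x]] by (simp add: abs_mult)
  have int: "integrable (\<mu> \<Otimes>\<^sub>M lborel) (\<lambda>(x, y). f y * gauss_density (y - x))"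
  proof (rule P.Fubini_integrable)
    have "norm (\<integral>y. norm (f y * gauss_density (y - x)) \<partial>lborel) \<le> B" for x
    proof -
      have "(\<integral>y. norm (f y * gauss_density (y - x)) \<partial>lborel) \<le> (\<integral>y. B * gauss_density (y - x) \<partial>lborel)"
        using int2 B
        by (intro integral_mono integrable_mult_right integrable_gauss_density_diff)
           (auto simp: abs_mult intro!: mult_right_mono)
      then show ?thesis
        by (simp add: integral_gauss_density_diff)
    qed
    then show "integrable \<mu> (\<lambda>x. \<integral>y. norm (case (x, y) of (x, y) \<Rightarrow> f y * gauss_density (y - x)) \<partial>lborel)"
      by (intro integrable_const_bound[where B=B]) auto
  qed (use int1 in auto)
  have "(\<integral>u. f (x + u) \<partial>gauss) = (\<integral>y. f y * gauss_density (y - x) \<partial>lborel)" for x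
  proof -
    have "(\<integral>u. f (x + u) \<partial>gauss) = (\<integral>u. f (x + u) * gauss_density ((x + u) - x) \<partial>lborel)"
      unfolding gauss_def by (subst integral_density) (auto simp: mult.commute)
    also have "\<dots> = (\<integral>y. f y * gauss_density (y - x) \<partial>lborel)"
      by (rule lborel_integral_translate) measurable
    finally show ?thesis .
  qed
  then have "(\<integral>x. (\<integral>u. f (x + u) \<partial>gauss) \<partial>\<mu>) =
      (\<integral>x. (\<integral>y. f y * gauss_density (y - x) \<partial>lborel) \<partial>\<mu>)"
    by simp
  also have "\<dots> = (\<integral>y. (\<integral>x. f y * gauss_density (y - x) \<partial>\<mu>) \<partial>lborel)"
    using P.Fubini_integral[OF int] by simp
  finally show "(\<integral>x. (\<integral>u. f (x + u) \<partial>gauss) \<partial>\<mu>) = (\<integral>y. f y * smoothed_density \<mu> y \<partial>lborel)"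
    by (simp add: smoothed_density_def)
  show "integrable lborel (\<lambda>y. f y * smoothed_density \<mu> y)"
    using P.integrable_snd[OF int] by (simp add: smoothed_density_def)
qed

lemma integrable_smoothed_density: "integrable lborel (smoothed_density \<mu>)"
  using integrable_smoothed_density_mult[of "\<lambda>_. 1" 1] by simp

lemma nn_integral_smoothed_density: "(\<integral>\<^sup>+y. ennreal (smoothed_density \<mu> y) \<partial>lborel) = 1"
proof -
  have "(\<integral>y. smoothed_density \<mu> y \<partial>lborel) = 1"
    using integral_gauss_translates[of "\<lambda>_. 1" 1] prob_space.prob_space[OF prob_space_gauss[where 'v='v]]
    by (simp add: prob_space)
  then show ?thesis
    by (subst nn_integral_eq_integral) (auto intro: integrable_smoothed_density)
qed

end

lemma gauss_borel_prob_space: "borel_prob_space (gauss :: 'v::euclidean_space measure)"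
  unfolding borel_prob_space_def borel_prob_space_axioms_def by (simp add: prob_space_gauss)

text \<open>
  After Gaussian smoothing, pointwise convergence of characteristic functions is enough for
  convergence of expectations, for every bounded Borel test function. By
  \<open>smoothed_density_eq_vchar\<close> and dominated convergence the smoothed densities converge
  pointwise; they are probability densities, so Scheffe's lemma turns this into convergence in \<open>L\<^sup>1\<close>.
\<close>

lemma smoothed_expectation_tendsto:
  fixes \<mu>s :: "nat \<Rightarrow> 'v::euclidean_space measure" and f :: "'v \<Rightarrow> real"
  assumes \<mu>s: "\<And>n. borel_prob_space (\<mu>s n)" and \<mu>: "borel_prob_space \<mu>"
    and vchar: "\<And>t. (\<lambda>n. vchar (\<mu>s n) t) \<longlonglongrightarrow> vchar \<mu> t"
    and f [measurable]: "f \<in> borel_measurable borel" and B: "\<And>v. \<bar>f v\<bar> \<le> B"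
  shows "(\<lambda>n. \<integral>x. (\<integral>u. f (x + u) \<partial>gauss) \<partial>\<mu>s n) \<longlonglongrightarrow> (\<integral>x. (\<integral>u. f (x + u) \<partial>gauss) \<partial>\<mu>)"
proof -
  interpret \<mu>: borel_prob_space \<mu> by fact
  interpret \<mu>s: borel_prob_space "\<mu>s n" for n by fact
  interpret \<gamma>: prob_space "gauss :: 'v measure" by (rule prob_space_gauss)
  let ?p = "\<lambda>n. smoothed_density (\<mu>s n)" and ?q = "smoothed_density \<mu>"
  have pointwise: "(\<lambda>n. ?p n y) \<longlonglongrightarrow> ?q y" for y
  proof -
    have "(\<lambda>n. \<integral>t. iexp (y \<bullet> t) * vchar (\<mu>s n) (- t) \<partial>gauss) \<longlonglongrightarrow>
        (\<integral>t. iexp (y \<bullet> t) * vchar \<mu> (- t) \<partial>gauss)"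
      by (rule integral_dominated_convergence[where w="\<lambda>_. 1"])
         (auto intro!: tendsto_mult vchar simp: norm_mult \<mu>s.norm_vchar_le_1)
    then have "(\<lambda>n. complex_of_real (?p n y)) \<longlonglongrightarrow> complex_of_real (?q y)"
      unfolding \<mu>s.smoothed_density_eq_vchar \<mu>.smoothed_density_eq_vchar by (intro tendsto_mult tendsto_const)
    then show ?thesis
      by (simp add: tendsto_of_real_iff)
  qed
  have "(\<lambda>n. \<integral>\<^sup>+y. norm (?p n y - ?q y) \<partial>lborel) \<longlonglongrightarrow> 0"
    by (rule Scheffe_lemma2)
       (auto intro!: AE_I2 pointwise \<mu>.integrable_smoothed_density
             simp: \<mu>s.nn_integral_smoothed_density \<mu>.nn_integral_smoothed_density)
  then have 0: "(\<lambda>n. ennreal B * (\<integral>\<^sup>+y. norm (?p n y - ?q y) \<partial>lborel)) \<longlonglongrightarrow> 0"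
    using ennreal_tendsto_cmult[of "ennreal B" _ 0] by simp
  have L1: "(\<lambda>n. \<integral>\<^sup>+y. norm (f y * ?p n y - f y * ?q y) \<partial>lborel) \<longlonglongrightarrow> 0"
  proof (rule tendsto_sandwich[OF _ _ tendsto_const 0])
    show "\<forall>\<^sub>F n in sequentially. (\<integral>\<^sup>+y. norm (f y * ?p n y - f y * ?q y) \<partial>lborel)
        \<le> ennreal B * (\<integral>\<^sup>+y. norm (?p n y - ?q y) \<partial>lborel)"
    proof (rule always_eventually, rule allI)
      fix n
      have "ennreal (norm (f y * ?p n y - f y * ?q y)) \<le> ennreal B * ennreal (norm (?p n y - ?q y))" for y
      proof -
        have "norm (f y * ?p n y - f y * ?q y) \<le> B * norm (?p n y - ?q y)"
          using B[of y] by (simp add: right_diff_distrib[symmetric] abs_mult mult_right_mono)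
        then show ?thesis
          using B[of y] by (subst ennreal_mult[symmetric]) (auto intro: ennreal_leI)
      qed
      then have "(\<integral>\<^sup>+y. norm (f y * ?p n y - f y * ?q y) \<partial>lborel)
          \<le> (\<integral>\<^sup>+y. ennreal B * norm (?p n y - ?q y) \<partial>lborel)"
        by (intro nn_integral_mono)
      then show "(\<integral>\<^sup>+y. norm (f y * ?p n y - f y * ?q y) \<partial>lborel)
        \<le> ennreal B * (\<integral>\<^sup>+y. norm (?p n y - ?q y) \<partial>lborel)"
        by (simp add: nn_integral_cmult)
    qed
  qed auto
  have "(\<lambda>n. \<integral>y. f y * ?p n y \<partial>lborel) \<longlonglongrightarrow> (\<integral>y. f y * ?q y \<partial>lborel)"
    by (rule tendsto_L1_int[OF _ _ L1])
       (rule \<mu>s.integrable_smoothed_density_mult[OF f B] \<mu>.integrable_smoothed_density_mult[OF f B])+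
  then show ?thesis
    by (simp add: \<mu>s.integral_gauss_translates[OF f B] \<mu>.integral_gauss_translates[OF f B])
qed

text \<open>
  Two independent standard normal vectors add up to a normal vector with covariance matrix twice the
  identity. Completing the square centres the integrand at \<open>y / 2\<close> and leaves a Gaussian of
  variance \<open>1 / 2\<close>, whence the substitution \<open>x = y / 2 + u / sqrt 2\<close>.
\<close>

lemma smoothed_density_gauss:
  "smoothed_density gauss (y::'v::euclidean_space) = exp (- (y \<bullet> y) / 4) / sqrt ((4 * pi) ^ DIM('v))"
proof -
  let ?d = "DIM('v)"
  define r :: real where "r = 1 / sqrt 2"
  have r: "r * r = 1 / 2" "r > 0"
    by (simp_all add: r_def)
  have meas: "(\<lambda>x. gauss_density x * gauss_density (y - x)) \<in> borel_measurable borel"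
    by measurable
  have "r \<noteq> 0" using r by simp
  note affine = lborel_integral_affine[OF meas this, of "(1/2) *\<^sub>R y"]
  have "smoothed_density gauss y = (\<integral>x. gauss_density x * gauss_density (y - x) \<partial>lborel)"
    unfolding smoothed_density_def gauss_def by (subst integral_density) auto
  also have "\<dots> = (\<integral>u. r ^ ?d * (gauss_density ((1/2) *\<^sub>R y + r *\<^sub>R u)
      * gauss_density (y - ((1/2) *\<^sub>R y + r *\<^sub>R u))) \<partial>lborel)"
    by (subst affine) (simp only: abs_of_pos[OF r(2)])
  also have "\<dots> = (\<integral>u. exp (- (y \<bullet> y) / 4) / sqrt ((4 * pi) ^ ?d) * gauss_density (u::'v) \<partial>lborel)"
  proof (rule Bochner_Integration.integral_cong[OF refl])
    fix u :: 'v
    let ?a = "(1/2) *\<^sub>R y + r *\<^sub>R u"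
    have "y - (1/2) *\<^sub>R y = (1 - 1/2) *\<^sub>R y"
      by (simp only: scaleR_left_diff_distrib scaleR_one)
    then have diff: "y - ?a = (1/2) *\<^sub>R y - r *\<^sub>R u"
      by (simp add: diff_diff_eq[symmetric])
    have "?a \<bullet> ?a + (y - ?a) \<bullet> (y - ?a) = (y \<bullet> y) / 2 + 2 * ((r * r) * (u \<bullet> u))"
      unfolding diff
      by (simp add: inner_add_left inner_add_right inner_diff_left inner_diff_right
          inner_commute[of u y] distrib_left right_diff_distrib add_divide_distrib diff_divide_distrib)
    then have "?a \<bullet> ?a + (y - ?a) \<bullet> (y - ?a) = (y \<bullet> y) / 2 + u \<bullet> u"
      by (simp add: r)
    then have exponents: "- (?a \<bullet> ?a) / 2 + - ((y - ?a) \<bullet> (y - ?a)) / 2 = - (y \<bullet> y) / 4 + - (u \<bullet> u) / 2"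
      by linarith
    have "4 * pi = 2 * (2 * pi)"
      by simp
    then have "(4 * pi) ^ ?d = 2 ^ ?d * (2 * pi) ^ ?d"
      by (simp only: power_mult_distrib)
    then have "sqrt ((4 * pi) ^ ?d) = sqrt 2 ^ ?d * sqrt ((2 * pi) ^ ?d)"
      by (simp only: real_sqrt_mult real_sqrt_power)
    then have constants: "r ^ ?d / sqrt ((2 * pi) ^ ?d) = 1 / sqrt ((4 * pi) ^ ?d)"
      by (simp only: r_def power_divide power_one divide_divide_eq_left)
    have "r ^ ?d * (gauss_density ?a * gauss_density (y - ?a)) =
        exp (- (?a \<bullet> ?a) / 2 + - ((y - ?a) \<bullet> (y - ?a)) / 2)
          * (r ^ ?d / sqrt ((2 * pi) ^ ?d)) / sqrt ((2 * pi) ^ ?d)"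
      unfolding gauss_density_def exp_add by (simp only: times_divide_eq_left times_divide_eq_right mult_ac)
    also have "\<dots> = exp (- (y \<bullet> y) / 4) / sqrt ((4 * pi) ^ ?d) * gauss_density u"
      unfolding exponents constants exp_add gauss_density_def
      by (simp only: times_divide_eq_left times_divide_eq_right divide_divide_eq_left mult_ac mult_1_left mult_1_right)
    finally show "r ^ ?d * (gauss_density ?a * gauss_density (y - ?a)) =
        exp (- (y \<bullet> y) / 4) / sqrt ((4 * pi) ^ ?d) * gauss_density u" .
  qed
  also have "\<dots> = exp (- (y \<bullet> y) / 4) / sqrt ((4 * pi) ^ ?d)"
    by (simp add: integral_gauss_density)
  finally show ?thesis .
qed

section \<open>Characteristic functions of normalised sums\<close>

text \<open>
  The central limit theorem at the level of characteristic functions and at the fixed argument \<open>1\<close>: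
  the \<open>n\<close>-th power is the characteristic function of the normalised sum of \<open>n\<close> independent copies.
  Only the one-step distribution occurs, so the copies may live in a different family for each \<open>n\<close>.
  The second order Taylor bound \<open>char_approx3\<close>, multiplied by \<open>n\<close>, leaves an error that vanishes
  by dominated convergence.
\<close>

lemma (in real_distribution) char_power_tendsto:
  assumes [simp]: "integrable M (\<lambda>x. x)" and mean: "expectation (\<lambda>x. x) = 0"
    and int2 [simp]: "integrable M (\<lambda>x. x\<^sup>2)" and var: "expectation (\<lambda>x. x\<^sup>2) = s"
  shows "(\<lambda>n. char M (1 / sqrt (real n)) ^ n) \<longlonglongrightarrow> exp (- s / 2)"
proof -
  let ?e = "\<lambda>n. expectation (\<lambda>x. min (6 * x\<^sup>2) (\<bar>1 / sqrt (real n)\<bar> * \<bar>x\<bar> ^ 3)) / 6"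
  have "s \<ge> 0"
    using var by (metis integral_nonneg_AE AE_I2 zero_le_power2)
  have main: "\<forall>\<^sub>F n in sequentially.
      cmod (char M (1 / sqrt (real n)) ^ n - of_real ((1 + (- s / 2) / real n) ^ n)) \<le> ?e n"
  proof (rule eventually_sequentiallyI)
    fix n :: nat
    \<comment> \<open>for these \<open>n\<close> also \<open>1 - s / (2 * n)\<close> lies in the closed unit disc, as \<open>norm_power_diff\<close> requires\<close>
    assume n: "n \<ge> nat \<lceil>s\<rceil> + 1"
    then have "s \<le> real n" "n > 0"
      by linarith+
    let ?r = "1 / sqrt (real n)"
    have r2: "?r\<^sup>2 = 1 / real n"
      by (simp add: power_divide)
    have "cmod (char M ?r - (1 - ?r\<^sup>2 * s / 2)) \<le> ?r\<^sup>2 / 6 * expectation (\<lambda>x. min (6 * x\<^sup>2) (\<bar>?r\<bar> * \<bar>x\<bar> ^ 3))"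
      using char_approx3[OF assms(1,2) int2, of s ?r] mean var by simp
    then have single: "cmod (char M ?r - of_real (1 + (- s / 2) / real n)) \<le> ?e n / real n"
      unfolding r2 by (simp add: ac_simps)
    have "\<bar>1 + (- s / 2) / real n\<bar> \<le> 1"
      using \<open>s \<le> real n\<close> \<open>n > 0\<close> \<open>s \<ge> 0\<close> by (auto simp: abs_le_iff field_simps)
    then have "cmod (char M ?r ^ n - of_real (1 + (- s / 2) / real n) ^ n)
        \<le> real n * cmod (char M ?r - of_real (1 + (- s / 2) / real n))"
      by (intro norm_power_diff cmod_char_le_1) (simp only: norm_of_real)
    also have "\<dots> \<le> real n * (?e n / real n)"
      by (intro mult_left_mono single) simp
    also have "\<dots> = ?e n"
      using \<open>n > 0\<close> by simp
    finally show "cmod (char M ?r ^ n - of_real ((1 + (- s / 2) / real n) ^ n)) \<le> ?e n"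
      by simp
  qed
  have "(\<lambda>n. min (6 * x\<^sup>2) (\<bar>1 / sqrt (real n)\<bar> * \<bar>x\<bar> ^ 3)) \<longlonglongrightarrow> 0" for x :: real
  proof -
    have "(\<lambda>n. 1 / sqrt (real n)) \<longlonglongrightarrow> 0"
      by (intro tendsto_divide_0[OF tendsto_const] filterlim_at_top_imp_at_infinity
            filterlim_compose[OF sqrt_at_top] filterlim_real_sequentially)
    then have "(\<lambda>n. \<bar>1 / sqrt (real n)\<bar> * \<bar>x\<bar> ^ 3) \<longlonglongrightarrow> \<bar>0\<bar> * \<bar>x\<bar> ^ 3"
      by (intro tendsto_mult tendsto_rabs tendsto_const)
    then have "(\<lambda>n. min (6 * x\<^sup>2) (\<bar>1 / sqrt (real n)\<bar> * \<bar>x\<bar> ^ 3)) \<longlonglongrightarrow> min (6 * x\<^sup>2) (\<bar>0\<bar> * \<bar>x\<bar> ^ 3)"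
      by (intro tendsto_min tendsto_const)
    moreover have "min (6 * x\<^sup>2) (\<bar>0\<bar> * \<bar>x\<bar> ^ 3) = 0"
      by simp
    ultimately show ?thesis by (simp only:)
  qed
  then have "(\<lambda>n. expectation (\<lambda>x. min (6 * x\<^sup>2) (\<bar>1 / sqrt (real n)\<bar> * \<bar>x\<bar> ^ 3))) \<longlonglongrightarrow> expectation (\<lambda>x. 0)"
    by (intro integral_dominated_convergence[where w="\<lambda>x. 6 * x\<^sup>2"]) auto
  then have lim0: "?e \<longlonglongrightarrow> 0"
    using tendsto_divide_zero by simp
  have "(\<lambda>n. complex_of_real ((1 + (- s / 2) / real n) ^ n)) \<longlonglongrightarrow> of_real (exp (- s / 2))"
    by (intro tendsto_of_real tendsto_exp_limit_sequentially)
  then have "(\<lambda>n. char M (1 / sqrt (real n)) ^ n) \<longlonglongrightarrow> of_real (exp (- s / 2))"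
    by (rule Lim_transform) (rule Lim_null_comparison[OF main lim0])
  then show ?thesis
    by simp
qed

text \<open>
  On the ray through \<open>t\<close> the characteristic function of \<open>\<mu>\<close> is the one of the projection \<open>x \<mapsto> t \<bullet> x\<close>.
\<close>

lemma (in borel_prob_space) vchar_power_tendsto:
  assumes int: "integrable \<mu> (\<lambda>x. t \<bullet> x)" and mean: "(\<integral>x. t \<bullet> x \<partial>\<mu>) = 0"
    and int2: "integrable \<mu> (\<lambda>x. (t \<bullet> x)\<^sup>2)" and var: "(\<integral>x. (t \<bullet> x)\<^sup>2 \<partial>\<mu>) = s"
  shows "(\<lambda>n. vchar \<mu> ((1 / sqrt (real n)) *\<^sub>R t) ^ n) \<longlonglongrightarrow> exp (- s / 2)"
proof -
  interpret T: real_distribution "distr \<mu> borel (\<lambda>x. t \<bullet> x)"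
    by (rule real_distribution_distr) measurable
  have "vchar \<mu> (c *\<^sub>R t) = char (distr \<mu> borel (\<lambda>x. t \<bullet> x)) c" for c
    unfolding vchar_def char_def by (subst integral_distr) auto
  moreover have "(\<lambda>n. char (distr \<mu> borel (\<lambda>x. t \<bullet> x)) (1 / sqrt (real n)) ^ n) \<longlonglongrightarrow> exp (- s / 2)"
    by (rule T.char_power_tendsto) (simp_all add: integrable_distr_eq integral_distr assms)
  ultimately show ?thesis
    by simp
qed

lemma borel_prob_space_distr:
  assumes "prob_space M" "X \<in> borel_measurable M"
  shows "borel_prob_space (distr M borel (X :: 'a \<Rightarrow> 'v::euclidean_space))"
  unfolding borel_prob_space_def borel_prob_space_axioms_def
  using prob_space.prob_space_distr[OF assms] by simp

context prob_space
begin

lemma vchar_distr_scaled_sum: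
  fixes Y :: "nat \<Rightarrow> 'a \<Rightarrow> 'v::euclidean_space"
  assumes indep: "indep_vars (\<lambda>_. borel) Y {..<n}"
    and distr: "\<And>k. k < n \<Longrightarrow> distr M borel (Y k) = \<nu>"
  shows "vchar (distr M borel (\<lambda>\<omega>. c *\<^sub>R (\<Sum>k<n. Y k \<omega>))) t = vchar \<nu> (c *\<^sub>R t) ^ n"
proof -
  have rv [measurable]: "Y k \<in> borel_measurable M" if "k < n" for k
    using indep that by (auto simp: indep_vars_def)
  have meas: "(\<lambda>\<omega>. c *\<^sub>R (\<Sum>k<n. Y k \<omega>)) \<in> borel_measurable M"
    using rv by (intro borel_measurable_scaleR borel_measurable_const borel_measurable_sum) auto
  have indep': "indep_vars (\<lambda>_. borel) (\<lambda>k \<omega>. iexp ((c *\<^sub>R t) \<bullet> Y k \<omega>)) {..<n}"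
    by (rule indep_vars_compose2[OF indep]) auto
  have "vchar (distr M borel (\<lambda>\<omega>. c *\<^sub>R (\<Sum>k<n. Y k \<omega>))) t
      = (\<integral>\<omega>. (\<Prod>k<n. iexp ((c *\<^sub>R t) \<bullet> Y k \<omega>)) \<partial>M)"
    unfolding vchar_def
    by (subst integral_distr[OF meas])
       (simp_all add: inner_sum_right sum_distrib_left exp_sum)
  also have "\<dots> = (\<Prod>k<n. \<integral>\<omega>. iexp ((c *\<^sub>R t) \<bullet> Y k \<omega>) \<partial>M)"
    using rv by (intro indep_vars_lebesgue_integral indep' integrable_iexp) auto
  also have "\<dots> = (\<Prod>k<n. vchar \<nu> (c *\<^sub>R t))"
  proof (rule prod.cong[OF refl])
    fix k assume "k \<in> {..<n}"
    then have k: "k < n" by simp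
    show "(\<integral>\<omega>. iexp ((c *\<^sub>R t) \<bullet> Y k \<omega>) \<partial>M) = vchar \<nu> (c *\<^sub>R t)"
      unfolding distr[OF k, symmetric] vchar_def
      by (subst integral_distr[OF rv[OF k]]) auto
  qed
  finally show ?thesis by simp
qed

lemma integral_indep_add:
  fixes X W :: "'a \<Rightarrow> 'v::euclidean_space" and f :: "'v \<Rightarrow> real"
  assumes indep: "indep_var borel X borel W"
    and f [measurable]: "f \<in> borel_measurable borel" and B: "\<And>v. \<bar>f v\<bar> \<le> B"
  shows "(\<integral>\<omega>. f (X \<omega> + W \<omega>) \<partial>M) = (\<integral>x. (\<integral>u. f (x + u) \<partial>distr M borel W) \<partial>distr M borel X)"
proof -
  have [measurable]: "X \<in> borel_measurable M" "W \<in> borel_measurable M"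
    using indep_var_rv1[OF indep] indep_var_rv2[OF indep] by auto
  interpret X: prob_space "distr M borel X" by (rule prob_space_distr) measurable
  interpret W: prob_space "distr M borel W" by (rule prob_space_distr) measurable
  interpret P: pair_prob_space "distr M borel X" "distr M borel W" ..
  have int: "integrable (distr M borel X \<Otimes>\<^sub>M distr M borel W) (\<lambda>p. f (fst p + snd p))"
    by (rule P.integrable_const_bound[where B=B]) (auto simp: B)
  have "(\<integral>\<omega>. f (X \<omega> + W \<omega>) \<partial>M) = (\<integral>p. f (fst p + snd p) \<partial>distr M (borel \<Otimes>\<^sub>M borel) (\<lambda>\<omega>. (X \<omega>, W \<omega>)))"
    by (subst integral_distr) auto
  also have "\<dots> = (\<integral>p. f (fst p + snd p) \<partial>(distr M borel X \<Otimes>\<^sub>M distr M borel W))"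
    using indep unfolding indep_var_distribution_eq by simp
  also have "\<dots> = (\<integral>x. (\<integral>u. f (x + u) \<partial>distr M borel W) \<partial>distr M borel X)"
    using P.integral_fst'[OF int] by simp
  finally show ?thesis .
qed

end

section \<open>Convergence to the centred normal distribution\<close>

lemma mat_mult_vec: "mat c *v (v::real^'n) = c *\<^sub>R v"
  by (simp add: matrix_vector_mult_def mat_def vec_eq_iff if_distrib[where f="\<lambda>x. x * _"] cong: if_cong)

lemma mat_mult:
  fixes A :: "real^'n^'n"
  shows "mat c ** A = c *\<^sub>R A" "A ** mat c = c *\<^sub>R A"
proof -
  have "(mat c ** A) *v x = (c *\<^sub>R A) *v x" for x
    unfolding matrix_vector_mul_assoc[symmetric] mat_mult_vec by (rule scaleR_matrix_vector_assoc)
  then show "mat c ** A = c *\<^sub>R A"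
    unfolding matrix_eq by blast
  have "(A ** mat c) *v x = (c *\<^sub>R A) *v x" for x
    unfolding matrix_vector_mul_assoc[symmetric] mat_mult_vec matrix_vector_mult_scaleR
    by (rule scaleR_matrix_vector_assoc)
  then show "A ** mat c = c *\<^sub>R A"
    unfolding matrix_eq by blast
qed

lemma mat_eq_scaleR: "(mat c :: real^'n^'n) = c *\<^sub>R mat 1"
  by (simp add: vec_eq_iff mat_def)

lemma mat_mult_mat: "(mat c :: real^'n^'n) ** mat d = mat (c * d)"
  unfolding mat_mult(1) by (simp add: vec_eq_iff mat_def)

lemma invertible_mat: "c \<noteq> 0 \<Longrightarrow> invertible (mat c :: real^'n^'n)"
  unfolding invertible_def by (rule exI[of _ "mat (1 / c)"]) (simp add: mat_mult_mat)

lemma centred_normal_mat: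
  assumes "c > 0"
  shows "centred_normal (mat c :: real^'n^'n) =
    density lborel (\<lambda>v. exp (- (v \<bullet> v) / (2 * c)) / sqrt ((2 * pi * c) ^ DIM(real^'n)))"
proof -
  have "matrix_inv (mat c :: real^'n^'n) ** mat c = mat 1"
  proof -
    have "invertible (mat c :: real^'n^'n)"
      using assms by (intro invertible_mat) simp
    then show ?thesis
      unfolding matrix_inv_def invertible_def by (rule someI2_ex) simp
  qed
  then have "matrix_inv (mat c :: real^'n^'n) ** (mat c ** mat (1 / c)) = mat (1 / c)"
    by (simp add: matrix_mul_assoc)
  then have "matrix_inv (mat c :: real^'n^'n) = mat (1 / c)"
    using assms by (simp add: mat_mult_mat)
  moreover have "det (mat c :: real^'n^'n) = c ^ CARD('n)"
    by (subst det_diagonal) (simp_all add: mat_def)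
  ultimately show ?thesis
    unfolding centred_normal_def by (simp add: mat_mult_vec power_mult_distrib mult.commute[of c 2])
qed

lemma centred_normal_1: "centred_normal (mat 1 :: real^'n^'n) = gauss"
  unfolding gauss_def gauss_density_def[abs_def] by (subst centred_normal_mat) simp_all

lemma centred_normal_2: "centred_normal (mat 2 :: real^'n^'n) = density lborel (smoothed_density gauss)"
  unfolding smoothed_density_gauss by (subst centred_normal_mat) simp_all

text \<open>
  Once the \<open>X n\<close> behave like standard normal vectors in the limit, the sums behave like the sum of two
  independent ones.
\<close>

lemma (in prob_space) converges_in_distribution_add_gauss:
  fixes X W :: "nat \<Rightarrow> 'a \<Rightarrow> real^'n"
  assumes indep: "\<And>n. indep_var borel (X n) borel (W n)"
    and W: "\<And>n. distr M borel (W n) = gauss"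
    and vchar: "\<And>t. (\<lambda>n. vchar (distr M borel (X n)) t) \<longlonglongrightarrow> exp (- (t \<bullet> t) / 2)"
  shows "converges_in_distribution M (\<lambda>n \<omega>. X n \<omega> + W n \<omega>) (centred_normal (mat 2))"
  unfolding converges_in_distribution_def
proof (intro allI impI)
  fix f :: "real^'n \<Rightarrow> real"
  assume f: "continuous_on UNIV f \<and> bounded (range f)"
  then have [measurable]: "f \<in> borel_measurable borel"
    by (intro borel_measurable_continuous_onI) simp
  obtain B where B: "\<And>v. \<bar>f v\<bar> \<le> B"
    using f by (auto simp: bounded_iff)
  interpret \<gamma>: borel_prob_space "gauss :: (real^'n) measure"
    by (rule gauss_borel_prob_space)
  have "(\<lambda>n. \<integral>x. (\<integral>u. f (x + u) \<partial>gauss) \<partial>distr M borel (X n))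
      \<longlonglongrightarrow> (\<integral>x. (\<integral>u. f (x + u) \<partial>gauss) \<partial>gauss)"
  proof (rule smoothed_expectation_tendsto[OF _ \<gamma>.borel_prob_space_axioms])
    show "borel_prob_space (distr M borel (X n))" for n
      by (rule borel_prob_space_distr[OF prob_space_axioms indep_var_rv1[OF indep]])
    show "(\<lambda>n. vchar (distr M borel (X n)) t) \<longlonglongrightarrow> vchar gauss t" for t
      using vchar by (simp add: vchar_gauss)
  qed (use B in auto)
  also have "(\<integral>x. (\<integral>u. f (x + u) \<partial>gauss) \<partial>gauss) = (\<integral>v. f v \<partial>centred_normal (mat 2))"
    unfolding centred_normal_2 using B
    by (subst \<gamma>.integral_gauss_translates[where B=B]) (simp_all add: integral_density mult.commute)
  finally show "(\<lambda>n. \<integral>\<omega>. f (X n \<omega> + W n \<omega>) \<partial>M) \<longlonglongrightarrow> (\<integral>v. f v \<partial>centred_normal (mat 2))"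
    using B by (subst integral_indep_add[OF indep, where B=B]) (simp_all add: W)
qed

section \<open>Independent families and standard normal vectors\<close>

lemma (in prob_space) indep_var_sum_next:
  fixes X :: "'i \<Rightarrow> 'a \<Rightarrow> 'v::euclidean_space"
  assumes "finite I" "i \<notin> I" and indep: "indep_vars (\<lambda>_. borel) X (insert i I)"
  shows "indep_var borel (\<lambda>\<omega>. \<Sum>j\<in>I. X j \<omega>) borel (X i)"
proof -
  have "indep_var
    borel ((\<lambda>f. \<Sum>j\<in>I. f j) \<circ> (\<lambda>\<omega>. restrict (\<lambda>j. X j \<omega>) I))
    borel ((\<lambda>f. f i) \<circ> (\<lambda>\<omega>. restrict (\<lambda>j. X j \<omega>) {i}))"
    using assms(1,2) by (intro indep_var_compose[OF indep_var_restrict[OF indep]]) auto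
  also have "(\<lambda>f. \<Sum>j\<in>I. f j) \<circ> (\<lambda>\<omega>. restrict (\<lambda>j. X j \<omega>) I) = (\<lambda>\<omega>. \<Sum>j\<in>I. X j \<omega>)"
    by (auto cong: rev_conj_cong)
  also have "(\<lambda>f. f i) \<circ> (\<lambda>\<omega>. restrict (\<lambda>j. X j \<omega>) {i}) = X i"
    by auto
  finally show ?thesis .
qed

lemma (in prob_space) indep_vars_reindex_inj:
  assumes indep: "indep_vars (\<lambda>_. N) X I" and h: "inj_on h J" "h ` J \<subseteq> I"
  shows "indep_vars (\<lambda>_. N) (\<lambda>j. X (h j)) J"
proof -
  have "indep_vars (\<lambda>j. PiM {h j} (\<lambda>_. N)) (\<lambda>j \<omega>. restrict (\<lambda>i. X i \<omega>) {h j}) J"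
    using h by (intro indep_vars_restrict[OF indep]) (auto simp: disjoint_family_on_def inj_on_def)
  then have "indep_vars (\<lambda>_. N) (\<lambda>j \<omega>. (\<lambda>f. f (h j)) (restrict (\<lambda>i. X i \<omega>) {h j})) J"
    by (rule indep_vars_compose2) auto
  then show ?thesis by simp
qed

lemma (in prob_space) distr_eq_gauss:
  fixes W :: "'a \<Rightarrow> 'v::euclidean_space"
  assumes indep: "indep_vars (\<lambda>_. borel) (\<lambda>b \<omega>. W \<omega> \<bullet> b) Basis"
    and std: "\<And>b. b \<in> Basis \<Longrightarrow> distr M borel (\<lambda>\<omega>. W \<omega> \<bullet> b) = std_normal_distribution"
  shows "distr M borel W = gauss"
proof -
  have rv [measurable]: "(\<lambda>\<omega>. W \<omega> \<bullet> b) \<in> borel_measurable M" if "b \<in> Basis" for b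
    using indep that by (auto simp: indep_vars_def)
  have "distr M (\<Pi>\<^sub>M b\<in>(Basis::'v set). borel) (\<lambda>\<omega>. \<lambda>b\<in>Basis. W \<omega> \<bullet> b)
      = (\<Pi>\<^sub>M b\<in>(Basis::'v set). distr M borel (\<lambda>\<omega>. W \<omega> \<bullet> b))"
    using indep by (subst indep_vars_iff_distr_eq_PiM'[symmetric]) auto
  also have "\<dots> = (\<Pi>\<^sub>M b\<in>(Basis::'v set). std_normal_distribution)"
    using std by (intro PiM_cong) auto
  finally have PiM: "distr M (\<Pi>\<^sub>M b\<in>(Basis::'v set). borel) (\<lambda>\<omega>. \<lambda>b\<in>Basis. W \<omega> \<bullet> b)
      = (\<Pi>\<^sub>M b\<in>(Basis::'v set). std_normal_distribution)" .
  have "(gauss :: 'v measure) = distr M borel ((\<lambda>f. \<Sum>b\<in>Basis. f b *\<^sub>R b) \<circ> (\<lambda>\<omega>. \<lambda>b\<in>Basis. W \<omega> \<bullet> b))"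
    unfolding distr_PiM_std_normal[symmetric] PiM[symmetric]
    by (rule distr_distr) (use rv in \<open>auto intro!: measurable_restrict\<close>)
  also have "(\<lambda>f. \<Sum>b\<in>Basis. f b *\<^sub>R b) \<circ> (\<lambda>\<omega>. \<lambda>b\<in>Basis. W \<omega> \<bullet> b) = W"
    by (auto simp: fun_eq_iff euclidean_representation)
  finally show ?thesis by simp
qed

section \<open>Whitening\<close>

lemma bilinear_form_eqI:
  fixes P Q :: "real^'n^'n"
  assumes "\<And>s t. s \<bullet> (P *v t) = s \<bullet> (Q *v t)"
  shows "P = Q"
  unfolding matrix_eq using assms by (metis vector_eq_ldot)

text \<open>
  The Gram-Schmidt process for the inner product \<open>B u v = u \<bullet> (P *v v)\<close>: orthonormal sets for \<open>B\<close> of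
  every size up to the dimension are built by induction, and the vectors of a largest one are the
  rows of \<open>C\<close>.
\<close>

lemma whitening_matrix_exists:
  fixes P :: "real^'n^'n"
  assumes P: "positive_definite P"
  obtains C :: "real^'n^'n" where "invertible C" "C ** P ** transpose C = mat 1"
proof -
  define B where "B u v = u \<bullet> (P *v v)" for u v :: "real^'n"
  have B_sym: "B u v = B v u" for u v
  proof -
    have "u v* P = P *v u"
      using P by (metis positive_definite_def transpose_matrix_vector)
    then show ?thesis
      using dot_lmul_matrix[of u P v] by (simp add: B_def inner_commute)
  qed
  have B_pos: "v \<noteq> 0 \<Longrightarrow> 0 < B v v" for v
    using P by (simp add: B_def positive_definite_def)
  have B_lin: "B u (v - w) = B u v - B u w" "B u (c *\<^sub>R v) = c * B u v"
      "B u (\<Sum>e\<in>E. g e *\<^sub>R e) = (\<Sum>e\<in>E. g e * B u e)" for u v w c E and g :: "_ \<Rightarrow> real"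
    by (simp_all add: B_def matrix_vector_mult_diff_distrib matrix_vector_mult_scaleR
        inner_diff_right vec.sum inner_sum_right)
  have extend: "\<exists>E. finite E \<and> card E = k \<and> (\<forall>e\<in>E. \<forall>f\<in>E. B e f = (if e = f then 1 else 0))"
    if "k \<le> CARD('n)" for k
    using that
  proof (induction k)
    case 0
    then show ?case by (intro exI[of _ "{}"]) simp
  next
    case (Suc k)
    then obtain E where E: "finite E" "card E = k"
        "\<And>e f. e \<in> E \<Longrightarrow> f \<in> E \<Longrightarrow> B e f = (if e = f then 1 else 0)"
      by auto
    have "span E \<noteq> UNIV"
    proof
      assume "span E = UNIV"
      then have "CARD('n) \<le> card E"
        using dim_le_card'[OF E(1)] by (metis DIM_cart DIM_real dim_UNIV dim_span mult.right_neutral)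
      with E(2) Suc.prems show False by simp
    qed
    then obtain v where v: "v \<notin> span E" by auto
    define v' where "v' = v - (\<Sum>e\<in>E. B e v *\<^sub>R e)"
    have "(\<Sum>e\<in>E. B e v *\<^sub>R e) \<in> span E"
      by (intro span_sum span_scale span_base)
    then have "v' \<noteq> 0"
      using v by (auto simp: v'_def)
    then have pos: "0 < B v' v'" by (rule B_pos)
    have orth: "B e v' = 0" if "e \<in> E" for e
    proof -
      have "(\<Sum>f\<in>E. B f v * B e f) = (\<Sum>f\<in>E. if f = e then B f v else 0)"
        using E(3) that by (intro sum.cong) auto
      then show ?thesis
        using E(1) that by (simp add: v'_def B_lin)
    qed
    define w where "w = (1 / sqrt (B v' v')) *\<^sub>R v'"
    have Bw: "B e w = 0" if "e \<in> E" for e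
      using orth[OF that] by (simp add: w_def B_lin)
    have "B w w = (1 / sqrt (B v' v')) * ((1 / sqrt (B v' v')) * B v' v')"
      by (simp add: w_def B_lin B_sym[of "_ *\<^sub>R _" v'])
    then have Bww: "B w w = 1"
      using pos by (simp add: field_simps)
    have "w \<notin> E"
      using Bw Bww by fastforce
    then show ?case
      using E Bw Bww B_sym by (intro exI[of _ "insert w E"]) (auto split: if_splits)
  qed
  from extend[OF order_refl] obtain E where E: "finite E" "card E = CARD('n)"
      and E_orth: "\<forall>e\<in>E. \<forall>f\<in>E. B e f = (if e = f then 1 else 0)"
    by (elim exE conjE)
  obtain r :: "'n \<Rightarrow> real^'n" where r: "bij_betw r UNIV E"
    using finite_same_card_bij[of "UNIV :: 'n set" E] E by auto
  define C :: "real^'n^'n" where "C = (\<chi> i. r i)"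
  have "(C ** P ** transpose C) $ i $ j = B (r i) (r j)" for i j
  proof -
    have "(C ** P ** transpose C) $ i $ j = (C ** (P ** transpose C)) $ i $ j"
      by (simp add: matrix_mul_assoc)
    also have "\<dots> = r i \<bullet> column j (P ** transpose C)"
      by (simp add: matrix_matrix_mult_def C_def column_def inner_vec_def)
    also have "column j (P ** transpose C) = P *v column j (transpose C)"
      by (simp add: matrix_vector_mult_def matrix_matrix_mult_def column_def)
    also have "column j (transpose C) = r j"
      by (simp add: column_def transpose_def C_def vec_eq_iff)
    finally show ?thesis by (simp add: B_def)
  qed
  moreover have "r i \<in> E" "r i = r j \<longleftrightarrow> i = j" for i j
    using r by (auto simp: bij_betw_def inj_on_def)
  ultimately have *: "C ** P ** transpose C = mat 1"
    by (simp add: vec_eq_iff mat_def E_orth)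
  then have "invertible C"
    by (metis invertible_right_inverse matrix_mul_assoc)
  with * that show thesis by blast
qed

section \<open>The vector space of random vectors\<close>

locale scatter_problem = prob_space M
  for M :: "'a measure" +
  fixes D :: "('a \<Rightarrow> real) set" and S :: "('a \<Rightarrow> real^'n) \<Rightarrow> real^'n^'n"
  assumes square_integrable: "square_integrable_class M D"
    and std_normal: "contains_std_normal M D"
    and affine: "closed_under_affine D"
    and addition: "closed_under_addition (random_vectors D :: ('a \<Rightarrow> real^'n) set)"
    and rich: "rich M (random_vectors D :: ('a \<Rightarrow> real^'n) set)"
    and scatter: "S \<in> standardized_scatter_functionals M (random_vectors D)"
    and continuous: "normal_continuous M (random_vectors D) S"
    and self_contained: "self_contained M (random_vectors D) S"
    and additive: "additive_functional M (random_vectors D) S"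
begin

abbreviation V :: "('a \<Rightarrow> real^'n) set" where
  "V \<equiv> random_vectors D"

lemma D_measurable: "x \<in> D \<Longrightarrow> x \<in> borel_measurable M"
  using square_integrable by (auto simp: square_integrable_class_def)

lemma D_square_integrable: "x \<in> D \<Longrightarrow> integrable M (\<lambda>\<omega>. (x \<omega>)\<^sup>2)"
  using square_integrable by (auto simp: square_integrable_class_def)

lemma D_integrable: "x \<in> D \<Longrightarrow> integrable M x"
  using square_integrable_imp_integrable[OF D_measurable D_square_integrable] .

lemma D_integrable_mult:
  assumes "x \<in> D" "y \<in> D"
  shows "integrable M (\<lambda>\<omega>. x \<omega> * y \<omega>)"
proof (rule Bochner_Integration.integrable_bound)
  show "integrable M (\<lambda>\<omega>. (x \<omega>)\<^sup>2 + (y \<omega>)\<^sup>2)"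
    using assms by (intro Bochner_Integration.integrable_add D_square_integrable)
  show "(\<lambda>\<omega>. x \<omega> * y \<omega>) \<in> borel_measurable M"
    using assms by (intro borel_measurable_times D_measurable)
  have "\<bar>a * b\<bar> \<le> a\<^sup>2 + b\<^sup>2" for a b :: real
  proof -
    have "2 * \<bar>a\<bar> * \<bar>b\<bar> \<le> a\<^sup>2 + b\<^sup>2"
      using sum_squares_bound[of "\<bar>a\<bar>" "\<bar>b\<bar>"] by simp
    moreover have "0 \<le> \<bar>a\<bar> * \<bar>b\<bar>"
      by simp
    ultimately show ?thesis
      unfolding abs_mult by linarith
  qed
  then show "AE \<omega> in M. norm (x \<omega> * y \<omega>) \<le> norm ((x \<omega>)\<^sup>2 + (y \<omega>)\<^sup>2)"
    by (intro AE_I2) simp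
qed

lemma V_D: "x \<in> V \<Longrightarrow> (\<lambda>\<omega>. x \<omega> $ i) \<in> D"
  by (simp add: random_vectors_def)

lemma V_add: "x \<in> V \<Longrightarrow> y \<in> V \<Longrightarrow> (\<lambda>\<omega>. x \<omega> + y \<omega>) \<in> V"
  using addition by (simp add: closed_under_addition_def)

text \<open>
  Closure under addition is assumed for vectors of one fixed dimension; it descends to \<open>D\<close> through
  vectors all of whose components agree.
\<close>

lemma D_add:
  assumes "x \<in> D" "y \<in> D"
  shows "(\<lambda>\<omega>. x \<omega> + y \<omega>) \<in> D"
proof -
  have "(\<lambda>\<omega>. (\<chi> i. x \<omega>) + (\<chi> i. y \<omega>) :: real^'n) \<in> V"
    using assms by (intro V_add) (simp_all add: random_vectors_def)
  from V_D[OF this] show ?thesis by simp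
qed

lemma D_scale_nonzero:
  assumes "x \<in> D" "a \<noteq> 0"
  shows "(\<lambda>\<omega>. a * x \<omega> + b) \<in> D"
proof -
  have "invertible_of_size 1 (\<lambda>_ _. a)"
    unfolding invertible_of_size_def using assms(2) by (intro exI[of _ "\<lambda>_ _. 1 / a"]) simp
  then show ?thesis
    using affine[unfolded closed_under_affine_def, rule_format, of 1 "\<lambda>_. x" "\<lambda>_ _. a" 0 "\<lambda>_. b"] assms(1)
    by simp
qed

text \<open>
  Dimension one of the affine closure gives \<open>- z + b\<close>, and adding \<open>z\<close> leaves the constant. Hence \<open>D\<close>
  is a vector space containing the constants, and random vectors may be multiplied by singular
  matrices as well.
\<close>

lemma D_const: "(\<lambda>_. b) \<in> D"
proof -
  obtain z where z: "z \<in> D"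
    using std_normal by (auto simp: contains_std_normal_def)
  have "(\<lambda>\<omega>. z \<omega> + ((-1) * z \<omega> + b)) \<in> D"
    by (intro D_add D_scale_nonzero z) simp
  then show ?thesis by simp
qed

lemma D_scale: "x \<in> D \<Longrightarrow> (\<lambda>\<omega>. a * x \<omega>) \<in> D"
  using D_scale_nonzero[of x a 0] D_const[of 0] by (cases "a = 0") simp_all

lemma D_sum: "finite I \<Longrightarrow> (\<And>i. i \<in> I \<Longrightarrow> x i \<in> D) \<Longrightarrow> (\<lambda>\<omega>. \<Sum>i\<in>I. x i \<omega>) \<in> D"
  by (induction I rule: finite_induct) (simp_all add: D_const D_add)

lemma V_inner_D:
  assumes "x \<in> V"
  shows "(\<lambda>\<omega>. s \<bullet> x \<omega>) \<in> D"
proof -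
  have "(\<lambda>\<omega>. \<Sum>i\<in>UNIV. s $ i * x \<omega> $ i) \<in> D"
    using assms by (intro D_sum D_scale V_D) simp_all
  then show ?thesis by (simp add: inner_vec_def)
qed

lemma V_affine:
  fixes A :: "real^'n^'n"
  assumes "x \<in> V"
  shows "(\<lambda>\<omega>. A *v x \<omega> + b) \<in> V"
proof -
  have "(\<lambda>\<omega>. A $ i \<bullet> x \<omega> + b $ i) \<in> D" for i
    by (intro D_add D_const V_inner_D assms)
  then show ?thesis
    by (simp add: random_vectors_def matrix_mult_dot)
qed

lemma V_scale: "x \<in> V \<Longrightarrow> (\<lambda>\<omega>. c *\<^sub>R x \<omega>) \<in> V"
  using V_affine[of x "mat c" 0] by (simp add: mat_mult_vec)

lemma V_translate: "x \<in> V \<Longrightarrow> (\<lambda>\<omega>. x \<omega> + b) \<in> V"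
  using V_affine[of x "mat 1" b] by simp

lemma V_zero: "(\<lambda>_. 0) \<in> V"
  by (simp add: random_vectors_def D_const)

lemma V_sum: "finite I \<Longrightarrow> (\<And>i. i \<in> I \<Longrightarrow> x i \<in> V) \<Longrightarrow> (\<lambda>\<omega>. \<Sum>i\<in>I. x i \<omega>) \<in> V"
  by (induction I rule: finite_induct) (simp_all add: V_zero V_add)

lemma V_measurable: "x \<in> V \<Longrightarrow> x \<in> borel_measurable M"
  by (subst borel_measurable_euclidean_space) (auto simp: inner_commute intro: D_measurable V_inner_D)

lemma V_integrable:
  assumes "x \<in> V"
  shows "integrable M x"
proof -
  have "integrable M (\<lambda>\<omega>. \<Sum>b\<in>Basis. (b \<bullet> x \<omega>) *\<^sub>R b)"
    using assms by (intro Bochner_Integration.integrable_sum integrable_scaleR_left D_integrable V_inner_D)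
  then show ?thesis
    by (simp add: inner_commute[of _ "x _"] euclidean_representation)
qed

section \<open>Covariance matrices of random vectors\<close>

lemma inner_expectation: "x \<in> V \<Longrightarrow> s \<bullet> expectation x = expectation (\<lambda>\<omega>. s \<bullet> x \<omega>)"
  using integral_inner_right[of s M x] V_integrable by simp

lemma expectation_nth: "x \<in> V \<Longrightarrow> expectation x $ i = expectation (\<lambda>\<omega>. x \<omega> $ i)"
  using inner_expectation[of x "axis i 1"] by (simp add: inner_axis')

text \<open>
  The covariance matrix as the bilinear form that it represents. This reduces its behaviour under
  affine maps and independent sums to linearity of the inner product.
\<close>

lemma covariance_form:
  assumes x: "x \<in> V"
  shows "s \<bullet> (covariance_matrix M x *v t) =
    expectation (\<lambda>\<omega>. (s \<bullet> (x \<omega> - expectation x)) * (t \<bullet> (x \<omega> - expectation x)))"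
proof -
  define y where "y \<omega> = x \<omega> - expectation x" for \<omega>
  have "y \<in> V"
    unfolding y_def using V_translate[OF x, of "- expectation x"] by simp
  then have int: "integrable M (\<lambda>\<omega>. s $ i * (t $ j * (y \<omega> $ i * y \<omega> $ j)))" for i j
    by (intro integrable_mult_right D_integrable_mult V_D)
  have "covariance_matrix M x $ i $ j = expectation (\<lambda>\<omega>. y \<omega> $ i * y \<omega> $ j)" for i j
    by (simp add: covariance_matrix_def y_def expectation_nth[OF x])
  then have "s \<bullet> (covariance_matrix M x *v t)
      = (\<Sum>i\<in>UNIV. \<Sum>j\<in>UNIV. expectation (\<lambda>\<omega>. s $ i * (t $ j * (y \<omega> $ i * y \<omega> $ j))))"
    by (simp add: inner_vec_def matrix_vector_mult_def sum_distrib_left mult_ac)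
  also have "\<dots> = expectation (\<lambda>\<omega>. \<Sum>i\<in>UNIV. \<Sum>j\<in>UNIV. s $ i * (t $ j * (y \<omega> $ i * y \<omega> $ j)))"
    using int by (simp add: Bochner_Integration.integral_sum Bochner_Integration.integrable_sum)
  also have "\<dots> = expectation (\<lambda>\<omega>. (s \<bullet> y \<omega>) * (t \<bullet> y \<omega>))"
    by (simp add: inner_vec_def sum_product mult_ac)
  finally show ?thesis by (simp add: y_def)
qed

lemma covariance_symmetric: "transpose (covariance_matrix M x) = covariance_matrix M x"
  by (simp add: transpose_def covariance_matrix_def mult.commute)

lemma covariance_nonneg: "x \<in> V \<Longrightarrow> 0 \<le> v \<bullet> (covariance_matrix M x *v v)"
  by (simp add: covariance_form)

lemma covariance_affine:
  fixes A :: "real^'n^'n"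
  assumes x: "x \<in> V"
  shows "covariance_matrix M (\<lambda>\<omega>. A *v x \<omega> + b) = A ** covariance_matrix M x ** transpose A"
proof (rule bilinear_form_eqI)
  fix s t :: "real^'n"
  have mean: "expectation (\<lambda>\<omega>. A *v x \<omega> + b) = A *v expectation x + b"
  proof (rule vector_eq_ldot[THEN iffD1], rule allI)
    fix s :: "real^'n"
    have "s \<bullet> expectation (\<lambda>\<omega>. A *v x \<omega> + b) = expectation (\<lambda>\<omega>. (s v* A) \<bullet> x \<omega> + s \<bullet> b)"
      by (subst inner_expectation[OF V_affine[OF x]]) (simp add: inner_add_right dot_lmul_matrix)
    also have "\<dots> = (s v* A) \<bullet> expectation x + s \<bullet> b"
      using D_integrable[OF V_inner_D[OF x]] by (simp add: inner_expectation[OF x] prob_space)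
    finally show "s \<bullet> expectation (\<lambda>\<omega>. A *v x \<omega> + b) = s \<bullet> (A *v expectation x + b)"
      by (simp add: inner_add_right dot_lmul_matrix)
  qed
  have "s \<bullet> (covariance_matrix M (\<lambda>\<omega>. A *v x \<omega> + b) *v t) =
      expectation (\<lambda>\<omega>. ((s v* A) \<bullet> (x \<omega> - expectation x)) * ((t v* A) \<bullet> (x \<omega> - expectation x)))"
    unfolding covariance_form[OF V_affine[OF x]] mean
    by (simp add: dot_lmul_matrix matrix_vector_mult_diff_distrib)
  also have "\<dots> = (s v* A) \<bullet> (covariance_matrix M x *v (t v* A))"
    by (simp add: covariance_form[OF x])
  also have "\<dots> = s \<bullet> ((A ** covariance_matrix M x ** transpose A) *v t)"
    by (simp add: dot_lmul_matrix matrix_vector_mul_assoc[symmetric])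
  finally show "s \<bullet> (covariance_matrix M (\<lambda>\<omega>. A *v x \<omega> + b) *v t) =
      s \<bullet> ((A ** covariance_matrix M x ** transpose A) *v t)" .
qed

lemma covariance_translate: "x \<in> V \<Longrightarrow> covariance_matrix M (\<lambda>\<omega>. x \<omega> + b) = covariance_matrix M x"
  using covariance_affine[of x "mat 1" b] by simp

lemma covariance_indep_add:
  assumes x: "x \<in> V" and y: "y \<in> V" and indep: "indep_var borel x borel y"
  shows "covariance_matrix M (\<lambda>\<omega>. x \<omega> + y \<omega>) = covariance_matrix M x + covariance_matrix M y"
proof (rule bilinear_form_eqI)
  fix s t :: "real^'n"
  define x' y' where "x' \<omega> = x \<omega> - expectation x" and "y' \<omega> = y \<omega> - expectation y" for \<omega>
  have x': "x' \<in> V" and y': "y' \<in> V"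
    unfolding x'_def y'_def
    using V_translate[OF x, of "- expectation x"] V_translate[OF y, of "- expectation y"] by simp_all
  have mean: "expectation (\<lambda>\<omega>. x \<omega> + y \<omega>) = expectation x + expectation y"
    using V_integrable x y by simp
  have "expectation x' = 0"
    using V_integrable[OF x] by (simp add: x'_def[abs_def] prob_space)
  then have centred: "expectation (\<lambda>\<omega>. u \<bullet> x' \<omega>) = 0" for u
    by (simp add: inner_expectation[OF x', symmetric])
  have cross: "expectation (\<lambda>\<omega>. (u \<bullet> x' \<omega>) * (v \<bullet> y' \<omega>)) = 0" for u v
  proof -
    have "indep_var borel ((\<lambda>z. u \<bullet> (z - expectation x)) \<circ> x) borel ((\<lambda>z. v \<bullet> (z - expectation y)) \<circ> y)"
      by (rule indep_var_compose[OF indep]) measurable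
    then have "indep_var borel (\<lambda>\<omega>. u \<bullet> x' \<omega>) borel (\<lambda>\<omega>. v \<bullet> y' \<omega>)"
      by (simp add: comp_def x'_def y'_def)
    from indep_var_lebesgue_integral[OF this] show ?thesis
      using x' y' centred by (simp add: D_integrable V_inner_D)
  qed
  have int: "integrable M (\<lambda>\<omega>. (u \<bullet> z \<omega>) * (v \<bullet> w \<omega>))" if "z \<in> V" "w \<in> V" for u v z w
    using that by (intro D_integrable_mult V_inner_D)
  have "s \<bullet> (covariance_matrix M (\<lambda>\<omega>. x \<omega> + y \<omega>) *v t)
      = expectation (\<lambda>\<omega>. (s \<bullet> (x' \<omega> + y' \<omega>)) * (t \<bullet> (x' \<omega> + y' \<omega>)))"
    unfolding covariance_form[OF V_add[OF x y]] mean by (simp add: x'_def y'_def add_diff_add)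
  also have "\<dots> = expectation (\<lambda>\<omega>. (s \<bullet> x' \<omega>) * (t \<bullet> x' \<omega>) + (s \<bullet> y' \<omega>) * (t \<bullet> y' \<omega>)
      + ((s \<bullet> x' \<omega>) * (t \<bullet> y' \<omega>) + (t \<bullet> x' \<omega>) * (s \<bullet> y' \<omega>)))"
    by (simp add: inner_add_right distrib_left distrib_right ac_simps)
  also have "\<dots> = expectation (\<lambda>\<omega>. (s \<bullet> x' \<omega>) * (t \<bullet> x' \<omega>)) + expectation (\<lambda>\<omega>. (s \<bullet> y' \<omega>) * (t \<bullet> y' \<omega>))"
    by (simp add: int x' y' cross)
  also have "\<dots> = s \<bullet> ((covariance_matrix M x + covariance_matrix M y) *v t)"
    by (simp add: matrix_vector_mult_add_rdistrib inner_add_right covariance_form x y x'_def y'_def)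
  finally show "s \<bullet> (covariance_matrix M (\<lambda>\<omega>. x \<omega> + y \<omega>) *v t) =
      s \<bullet> ((covariance_matrix M x + covariance_matrix M y) *v t)" .
qed

lemma covariance_cong_distr:
  assumes "x \<in> V" "y \<in> V" and eq: "distr M borel x = distr M borel y"
  shows "covariance_matrix M x = covariance_matrix M y"
proof -
  have "expectation (\<lambda>\<omega>. f (x \<omega>)) = expectation (\<lambda>\<omega>. f (y \<omega>))"
    if "f \<in> borel_measurable borel" for f :: "real^'n \<Rightarrow> real"
    using that assms(1,2) by (metis V_measurable eq integral_distr)
  from this[of "\<lambda>z. z $ i" for i] this[of "\<lambda>z. (z $ i - a) * (z $ j - b)" for i j a b]
  show ?thesis
    by (simp add: covariance_matrix_def)
qed

section \<open>The scatter functional\<close>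

lemma S_affine: "x \<in> V \<Longrightarrow> invertible A \<Longrightarrow> S (\<lambda>\<omega>. A *v x \<omega> + b) = A ** S x ** transpose A"
  using scatter by (simp add: standardized_scatter_functionals_def scatter_functional_def)

lemma S_translate: "x \<in> V \<Longrightarrow> S (\<lambda>\<omega>. x \<omega> + b) = S x"
  using S_affine[of x "mat 1" b] by (simp add: invertible_mat)

lemma S_scale:
  assumes "x \<in> V" "c \<noteq> 0"
  shows "S (\<lambda>\<omega>. c *\<^sub>R x \<omega>) = c\<^sup>2 *\<^sub>R S x"
  using S_affine[OF assms(1) invertible_mat[OF assms(2)], of 0]
  by (simp add: mat_mult_vec mat_mult power2_eq_square transpose_mat)

lemma S_zero: "S (\<lambda>_. 0) = 0"
  using S_scale[OF V_zero, of 2] scaleR_cancel_right[of 4 "S (\<lambda>_. 0)" 1] by simp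

lemma S_indep_add:
  "x \<in> V \<Longrightarrow> y \<in> V \<Longrightarrow> indep_var borel x borel y \<Longrightarrow> S (\<lambda>\<omega>. x \<omega> + y \<omega>) = S x + S y"
  using additive by (simp add: additive_functional_def)

lemma S_cong_distr: "x \<in> V \<Longrightarrow> y \<in> V \<Longrightarrow> distr M borel x = distr M borel y \<Longrightarrow> S x = S y"
  using self_contained unfolding self_contained_def by blast

lemma S_gauss: "w \<in> V \<Longrightarrow> distr M borel w = gauss \<Longrightarrow> S w = mat 1"
  using scatter by (simp add: standardized_scatter_functionals_def centred_normal_1)

lemma S_tendsto_normal:
  assumes "positive_definite \<Sigma>" "\<And>n. u n \<in> V" "\<And>n. expectation (u n) = 0"
    and "converges_in_distribution M u (centred_normal \<Sigma>)"
  shows "(\<lambda>n. S (u n)) \<longlonglongrightarrow> \<Sigma>"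
  using continuous[unfolded normal_continuous_def, rule_format, of \<Sigma> u] assms by simp

lemma expectation_cong_distr:
  assumes "x \<in> V" "y \<in> V" and eq: "distr M borel x = distr M borel y"
  shows "expectation x = expectation y"
proof -
  have "expectation z = (\<integral>v. v \<partial>distr M borel z)" if "z \<in> V" for z
    using V_measurable[OF that] by (subst integral_distr) auto
  then show ?thesis
    using assms by metis
qed

lemma independent_copies:
  fixes n :: nat
  shows "(\<And>k. k < n \<Longrightarrow> x k \<in> V) \<Longrightarrow>
    \<exists>y. (\<forall>k<n. y k \<in> V \<and> distr M borel (y k) = distr M borel (x k)) \<and> indep_vars (\<lambda>_. borel) y {..<n}"
  using rich[unfolded rich_def, rule_format, of n x] by simp

lemma independent_pair:
  assumes "x \<in> V" "w \<in> V"
  shows "\<exists>a b. a \<in> V \<and> distr M borel a = distr M borel x \<and> b \<in> V \<and> distr M borel b = distr M borel w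
    \<and> indep_var borel a borel b"
proof -
  have "(if k = 0 then x else w) \<in> V" for k :: nat
    using assms by simp
  from independent_copies[of 2 "\<lambda>k. if k = 0 then x else w", OF this]
  obtain y where y: "\<forall>k<2. y k \<in> V \<and> distr M borel (y k) = distr M borel (if k = 0 then x else w)"
    and indep: "indep_vars (\<lambda>_. borel) y {..<2::nat}"
    by (elim exE conjE)
  have "indep_vars (\<lambda>_. borel) y (insert 1 {..<1})"
    by (rule indep_vars_subset[OF indep]) auto
  from indep_var_sum_next[OF _ _ this] have "indep_var borel (y 0) borel (y 1)"
    by simp
  then show ?thesis
    using y[rule_format, of 0] y[rule_format, of 1] by (intro exI[of _ "y 0"] exI[of _ "y 1"]) simp
qed

lemma std_normal_moments:
  assumes "f \<in> D" and std: "distr M borel f = std_normal_distribution"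
  shows "expectation f = 0" "expectation (\<lambda>\<omega>. (f \<omega>)\<^sup>2) = 1"
proof -
  have "expectation (\<lambda>\<omega>. g (f \<omega>)) = (\<integral>x. std_normal_density x * g x \<partial>lborel)"
    if "g \<in> borel_measurable borel" for g :: "real \<Rightarrow> real"
  proof -
    have "expectation (\<lambda>\<omega>. g (f \<omega>)) = (\<integral>x. g x \<partial>std_normal_distribution)"
      unfolding std[symmetric] using D_measurable[OF assms(1)] that by (simp add: integral_distr)
    also have "\<dots> = (\<integral>x. std_normal_density x * g x \<partial>lborel)"
      using that by (subst integral_density) auto
    finally show ?thesis .
  qed
  from this[of "\<lambda>x. x"] this[of "\<lambda>x. x\<^sup>2"]
  show "expectation f = 0" "expectation (\<lambda>\<omega>. (f \<omega>)\<^sup>2) = 1"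
    using integral_std_normal_moment_odd[of 0] integral_std_normal_moment_even[of 1]
    by (simp_all add: numeral_2_eq_2)
qed

text \<open>
  The assumptions provide normal variables in dimension one. The vector with all
  components equal to such a variable is degenerate in dimension two and higher, but richness yields as many independent copies
  of it as there are basis vectors, and taking the \<open>b\<close>-component from the copy with number \<open>h b\<close>
  makes the components independent.
\<close>

lemma normal_vector_exists:
  obtains w where "w \<in> V" "distr M borel w = gauss" "expectation w = 0" "covariance_matrix M w = mat 1"
proof -
  obtain z where z: "z \<in> D" "distr M borel z = std_normal_distribution"
    using std_normal by (auto simp: contains_std_normal_def)
  define c :: "'a \<Rightarrow> real^'n" where "c \<omega> = (\<chi> i. z \<omega>)" for \<omega>
  have c: "c \<in> V" and c_Basis: "c \<omega> \<bullet> b = z \<omega>" if "b \<in> Basis" for b \<omega>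
    using z(1) that by (auto simp: c_def random_vectors_def Basis_vec_def inner_axis)
  obtain y where y: "\<And>k. k < DIM(real^'n) \<Longrightarrow> y k \<in> V"
      "\<And>k. k < DIM(real^'n) \<Longrightarrow> distr M borel (y k) = distr M borel c"
    and indep: "indep_vars (\<lambda>_. borel) y {..<DIM(real^'n)}"
    using independent_copies[of "DIM(real^'n)" "\<lambda>_. c"] c SOME_Basis by blast
  obtain h where h: "bij_betw h (Basis :: (real^'n) set) {..<DIM(real^'n)}"
    using ex_bij_betw_finite_nat[of "Basis :: (real^'n) set"] by (auto simp: atLeast0LessThan)
  have h_less: "h b < DIM(real^'n)" if "b \<in> Basis" for b
    using h that by (auto simp: bij_betw_def)
  define w where "w \<omega> = (\<Sum>b\<in>Basis. (y (h b) \<omega> \<bullet> b) *\<^sub>R b)" for \<omega>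
  have w_inner: "w \<omega> \<bullet> b = y (h b) \<omega> \<bullet> b" if "b \<in> Basis" for b \<omega>
    using that by (simp add: w_def)
  have w: "w \<in> V"
  proof -
    have "(\<lambda>\<omega>. (y (h b) \<omega> \<bullet> b) *\<^sub>R b) \<in> V" if "b \<in> Basis" for b
    proof -
      have "(\<lambda>\<omega>. b $ i * (b \<bullet> y (h b) \<omega>)) \<in> D" for i
        by (intro D_scale V_inner_D y(1) h_less that)
      then show ?thesis
        by (simp add: random_vectors_def inner_commute mult.commute)
    qed
    then show ?thesis
      unfolding w_def[abs_def] by (intro V_sum) auto
  qed
  have std: "distr M borel (\<lambda>\<omega>. w \<omega> \<bullet> b) = std_normal_distribution" if b: "b \<in> Basis" for b
  proof -
    have "distr M borel (\<lambda>\<omega>. w \<omega> \<bullet> b) = distr (distr M borel (y (h b))) borel (\<lambda>v. v \<bullet> b)"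
      using V_measurable[OF y(1)[OF h_less[OF b]]]
      by (subst distr_distr) (simp_all add: comp_def w_inner[OF b])
    also have "\<dots> = distr (distr M borel c) borel (\<lambda>v. v \<bullet> b)"
      by (simp only: y(2)[OF h_less[OF b]])
    also have "\<dots> = distr M borel z"
      using V_measurable[OF c[OF b]] by (subst distr_distr) (simp_all add: comp_def c_Basis[OF b])
    finally show ?thesis using z(2) by simp
  qed
  have "indep_vars (\<lambda>_. borel) (\<lambda>b. y (h b)) Basis"
    using h by (intro indep_vars_reindex_inj[OF indep]) (auto simp: bij_betw_def)
  then have "indep_vars (\<lambda>_. borel) (\<lambda>b \<omega>. y (h b) \<omega> \<bullet> b) Basis"
    by (rule indep_vars_compose2) auto
  then have w_indep: "indep_vars (\<lambda>_. borel) (\<lambda>b \<omega>. w \<omega> \<bullet> b) Basis"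
    by (rule indep_vars_cong[THEN iffD1, rotated -1]) (auto simp: w_inner)
  have component: "expectation (\<lambda>\<omega>. w \<omega> $ i) = 0" "expectation (\<lambda>\<omega>. (w \<omega> $ i)\<^sup>2) = 1" for i
    using std_normal_moments[OF V_D[OF w, of i]] std[of "axis i 1"]
    by (simp_all add: inner_axis axis_in_Basis_iff)
  have uncorrelated: "expectation (\<lambda>\<omega>. w \<omega> $ i * w \<omega> $ j) = 0" if "i \<noteq> j" for i j
  proof -
    let ?I = "{axis i 1, axis j 1} :: (real^'n) set"
    have "expectation (\<lambda>\<omega>. \<Prod>b\<in>?I. w \<omega> \<bullet> b) = (\<Prod>b\<in>?I. expectation (\<lambda>\<omega>. w \<omega> \<bullet> b))"
    proof (rule indep_vars_lebesgue_integral)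
      show "indep_vars (\<lambda>_. borel) (\<lambda>b \<omega>. w \<omega> \<bullet> b) ?I"
        by (rule indep_vars_subset[OF w_indep]) (simp add: axis_in_Basis_iff)
      show "integrable M (\<lambda>\<omega>. w \<omega> \<bullet> b)" for b
        using D_integrable[OF V_inner_D[OF w, of b]] by (simp add: inner_commute)
    qed simp
    moreover have "axis i 1 \<noteq> (axis j 1 :: real^'n)"
      using that by (simp add: axis_eq_axis)
    ultimately show ?thesis
      by (simp add: inner_axis component)
  qed
  show thesis
  proof
    show "distr M borel w = gauss"
      by (rule distr_eq_gauss[OF w_indep std])
    show "expectation w = 0"
      by (simp add: vec_eq_iff expectation_nth[OF w] component)
    show "covariance_matrix M w = mat 1"
      using component(2) by (simp add: vec_eq_iff covariance_matrix_def mat_def component(1) uncorrelated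
          power2_eq_square)
  qed (rule w)
qed

text \<open>
  The heart of the proof. Let \<open>T n n\<close> be a sum of \<open>n\<close> independent copies of the centred \<open>x\<close> and \<open>W n\<close>
  an independent standard normal vector. On \<open>T n n / sqrt n + W n\<close> for \<open>n > 0\<close> the functional takes the
  constant value \<open>S x + mat 1\<close>: additivity multiplies \<open>S x\<close> by \<open>n\<close> and equivariance divides it by \<open>n\<close> again.
  These vectors converge in distribution to the centred normal with covariance matrix \<open>mat 2\<close>, so
  that normal continuity gives \<open>S x + mat 1 = mat 2\<close>.
\<close>

lemma S_eq_mat_1:
  assumes x: "x \<in> V" and cov: "covariance_matrix M x = mat 1"
  shows "S x = mat 1"
proof -
  obtain w where w: "w \<in> V" "distr M borel w = gauss" "expectation w = 0"
    by (rule normal_vector_exists)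
  define x0 where "x0 \<omega> = x \<omega> - expectation x" for \<omega>
  have x0: "x0 \<in> V" and S_x0: "S x0 = S x" and cov_x0: "covariance_matrix M x0 = mat 1"
    using V_translate[OF x, of "- expectation x"] S_translate[OF x, of "- expectation x"]
      covariance_translate[OF x, of "- expectation x"] cov by (simp_all add: x0_def[abs_def])
  have mean_x0: "expectation x0 = 0"
    using V_integrable[OF x] by (simp add: x0_def[abs_def] prob_space)
  \<comment> \<open>for each \<open>n\<close> a fresh list: \<open>n\<close> copies of \<open>x0\<close>, and the normal vector at position \<open>n\<close>\<close>
  have "\<exists>y. (\<forall>k<Suc n. y k \<in> V \<and> distr M borel (y k) = distr M borel (if k < n then x0 else w))
      \<and> indep_vars (\<lambda>_. borel) y {..<Suc n}" for n :: nat
  proof -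
    have "(if k < n then x0 else w) \<in> V" for k
      using x0 w(1) by simp
    then show ?thesis
      by (rule independent_copies[of "Suc n" "\<lambda>k. if k < n then x0 else w"])
  qed
  then have "\<exists>y. \<forall>n. (\<forall>k<Suc n. y n k \<in> V \<and> distr M borel (y n k) = distr M borel (if k < n then x0 else w))
      \<and> indep_vars (\<lambda>_. borel) (y n) {..<Suc n}"
    by (intro choice allI)
  then obtain y where y: "\<And>n k. k < Suc n \<Longrightarrow> y n k \<in> V"
      "\<And>n k. k < Suc n \<Longrightarrow> distr M borel (y n k) = distr M borel (if k < n then x0 else w)"
    and indep: "\<And>n. indep_vars (\<lambda>_. borel) (y n) {..<Suc n}"
    by auto
  define T where "T n m \<omega> = (\<Sum>k<m. y n k \<omega>)" for n m \<omega>
  define X where "X n \<omega> = (1 / sqrt (real n)) *\<^sub>R T n n \<omega>" for n \<omega>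
  define W where "W n = y n n" for n
  have T_V: "T n m \<in> V" if "m \<le> Suc n" for n m
    unfolding T_def[abs_def] using that y(1) by (intro V_sum) auto
  have X_V: "X n \<in> V" and W_V: "W n \<in> V" for n
    using V_scale[OF T_V] y(1) by (simp_all add: X_def[abs_def] W_def)
  have W_gauss: "distr M borel (W n) = gauss" for n
    using y(2)[of n n] w(2) by (simp add: W_def)
  have T_indep: "indep_var borel (T n m) borel (y n m)" if "m \<le> n" for n m
  proof -
    have "indep_vars (\<lambda>_. borel) (y n) (insert m {..<m})"
      by (rule indep_vars_subset[OF indep[of n]]) (use that in auto)
    from indep_var_sum_next[OF _ _ this] show ?thesis
      by (simp add: T_def[abs_def])
  qed
  have X_indep: "indep_var borel (X n) borel (W n)" for n
  proof -
    have "indep_var borel ((\<lambda>v. (1 / sqrt (real n)) *\<^sub>R v) \<circ> T n n) borel ((\<lambda>v. v) \<circ> y n n)"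
      by (rule indep_var_compose[OF T_indep[OF order_refl]]) measurable
    then show ?thesis
      unfolding comp_def X_def[abs_def] W_def .
  qed
  have S_T: "S (T n m) = real m *\<^sub>R S x" if "m \<le> n" for n m
    using that
  proof (induction m)
    case 0
    then show ?case by (simp add: T_def[abs_def] S_zero)
  next
    case (Suc m)
    have "S (T n (Suc m)) = S (\<lambda>\<omega>. T n m \<omega> + y n m \<omega>)"
      by (simp add: T_def[abs_def])
    also have "\<dots> = S (T n m) + S (y n m)"
      using Suc.prems by (intro S_indep_add T_V T_indep y(1)) auto
    also have "S (y n m) = S x"
      using S_cong_distr[OF y(1) x0, of m n] y(2)[of m n] Suc.prems by (simp add: S_x0)
    finally show ?case
      using Suc by (simp add: scaleR_add_left add.commute)
  qed
  \<comment> \<open>for \<open>n = 0\<close> the factor \<open>1 / sqrt n\<close> is \<open>0\<close> and the value is \<open>mat 1\<close> instead\<close>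
  have S_sum: "S (\<lambda>\<omega>. X n \<omega> + W n \<omega>) = S x + mat 1" if "n > 0" for n
  proof -
    have "S (X n) = (1 / sqrt (real n))\<^sup>2 *\<^sub>R S (T n n)"
      unfolding X_def[abs_def] using that by (intro S_scale T_V) auto
    also have "\<dots> = S x"
      using that by (simp add: S_T power_divide)
    finally show ?thesis
      by (simp add: S_indep_add X_V W_V X_indep S_gauss W_gauss)
  qed
  interpret \<nu>: borel_prob_space "distr M borel x0"
    by (rule borel_prob_space_distr[OF prob_space_axioms V_measurable[OF x0]])
  have "(\<lambda>n. vchar (distr M borel (X n)) t) \<longlonglongrightarrow> exp (- (t \<bullet> t) / 2)" for t
  proof -
    have "vchar (distr M borel (X n)) t = vchar (distr M borel x0) ((1 / sqrt (real n)) *\<^sub>R t) ^ n" for n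
      unfolding X_def[abs_def] T_def
    proof (rule vchar_distr_scaled_sum)
      show "indep_vars (\<lambda>_. borel) (y n) {..<n}"
        by (rule indep_vars_subset[OF indep[of n]]) auto
    qed (simp add: y(2))
    moreover have "(\<lambda>n. vchar (distr M borel x0) ((1 / sqrt (real n)) *\<^sub>R t) ^ n) \<longlonglongrightarrow> exp (- (t \<bullet> t) / 2)"
    proof (rule \<nu>.vchar_power_tendsto)
      have "expectation (\<lambda>\<omega>. (t \<bullet> x0 \<omega>)\<^sup>2) = t \<bullet> t"
        using covariance_form[OF x0, of t t] by (simp add: mean_x0 cov_x0 power2_eq_square)
      then show "(\<integral>v. (t \<bullet> v)\<^sup>2 \<partial>distr M borel x0) = t \<bullet> t"
        using V_measurable[OF x0] by (simp add: integral_distr)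
      show "(\<integral>v. t \<bullet> v \<partial>distr M borel x0) = 0"
        using V_measurable[OF x0] inner_expectation[OF x0, of t] by (simp add: integral_distr mean_x0)
      show "integrable (distr M borel x0) (\<lambda>v. t \<bullet> v)" "integrable (distr M borel x0) (\<lambda>v. (t \<bullet> v)\<^sup>2)"
        using V_measurable[OF x0] D_integrable[OF V_inner_D[OF x0, of t]] D_square_integrable[OF V_inner_D[OF x0, of t]]
        by (simp_all add: integrable_distr_eq)
    qed
    ultimately show ?thesis by simp
  qed
  then have conv: "converges_in_distribution M (\<lambda>n \<omega>. X n \<omega> + W n \<omega>) (centred_normal (mat 2))"
    by (intro converges_in_distribution_add_gauss X_indep W_gauss)
  have mean: "expectation (\<lambda>\<omega>. X n \<omega> + W n \<omega>) = 0" for n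
  proof -
    have mean_y: "expectation (y n k) = 0" if "k < Suc n" for k
      using expectation_cong_distr[OF y(1)[OF that], of "if k < n then x0 else w"] y(2)[OF that]
        x0 w mean_x0 by (simp split: if_splits)
    have "expectation (T n n) = (\<Sum>k<n. expectation (y n k))"
      unfolding T_def[abs_def] by (rule Bochner_Integration.integral_sum) (simp add: V_integrable y(1))
    then have "expectation (T n n) = 0" "expectation (W n) = 0"
      using mean_y by (simp_all add: W_def)
    then show ?thesis
      using V_integrable[OF X_V] V_integrable[OF W_V] V_integrable[OF T_V[of n n]] by (simp add: X_def[abs_def])
  qed
  have "positive_definite (mat 2 :: real^'n^'n)"
    by (simp add: positive_definite_def transpose_mat mat_mult_vec)
  then have "(\<lambda>n. S (\<lambda>\<omega>. X n \<omega> + W n \<omega>)) \<longlonglongrightarrow> mat 2"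
    by (rule S_tendsto_normal[OF _ V_add[OF X_V W_V] mean conv])
  moreover have "\<forall>\<^sub>F n in sequentially. S (\<lambda>\<omega>. X n \<omega> + W n \<omega>) = S x + mat 1"
    by (rule eventually_sequentiallyI[of 1]) (simp add: S_sum)
  then have "(\<lambda>n. S (\<lambda>\<omega>. X n \<omega> + W n \<omega>)) \<longlonglongrightarrow> S x + mat 1"
    by (rule tendsto_eventually)
  ultimately have "S x + mat 1 = mat 2"
    using LIMSEQ_unique by blast
  also have "mat 2 = mat 1 + (mat 1 :: real^'n^'n)"
    unfolding mat_eq_scaleR[of 2] by (rule scaleR_2)
  finally show ?thesis
    by (simp only: add_right_cancel)
qed

text \<open>
  Both sides are equivariant under the invertible matrix \<open>C\<close> that whitens \<open>x\<close>, and they agree on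
  \<open>C *v x\<close>.
\<close>

lemma S_eq_covariance_if_positive_definite:
  assumes x: "x \<in> V" and pd: "positive_definite (covariance_matrix M x)"
  shows "S x = covariance_matrix M x"
proof -
  obtain C :: "real^'n^'n" where C: "invertible C" "C ** covariance_matrix M x ** transpose C = mat 1"
    using whitening_matrix_exists[OF pd] .
  have "S (\<lambda>\<omega>. C *v x \<omega> + 0) = mat 1"
    by (rule S_eq_mat_1[OF V_affine[OF x]]) (simp only: covariance_affine[OF x] C(2))
  then have eq: "C ** S x ** transpose C = C ** covariance_matrix M x ** transpose C"
    unfolding S_affine[OF x C(1)] C(2) .
  obtain C' where C': "C' ** C = mat 1"
    using C(1) by (auto simp: invertible_def)
  have cancel: "C' ** (C ** P ** transpose C) ** transpose C' = P" for P :: "real^'n^'n"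
  proof -
    have "C' ** (C ** P ** transpose C) ** transpose C' = (C' ** C) ** P ** transpose (C' ** C)"
      by (simp only: matrix_mul_assoc matrix_transpose_mul)
    then show ?thesis
      by (simp add: C' transpose_mat)
  qed
  have "S x = C' ** (C ** S x ** transpose C) ** transpose C'"
    by (rule cancel[symmetric])
  also have "\<dots> = covariance_matrix M x"
    unfolding eq by (rule cancel)
  finally show ?thesis .
qed

text \<open>
  Adding an independent standard normal vector makes any covariance matrix positive definite, and
  changes \<open>S\<close> and the covariance matrix by the same summand \<open>mat 1\<close>.
\<close>

lemma S_eq_covariance:
  assumes x: "x \<in> V"
  shows "S x = covariance_matrix M x"
proof -
  obtain w where w: "w \<in> V" "distr M borel w = gauss" "covariance_matrix M w = mat 1"
    by (rule normal_vector_exists)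
  obtain a b where a: "a \<in> V" "distr M borel a = distr M borel x"
    and b: "b \<in> V" "distr M borel b = distr M borel w" and indep: "indep_var borel a borel b"
    using independent_pair[OF x w(1)] by auto
  let ?u = "\<lambda>\<omega>. a \<omega> + b \<omega>"
  have cov: "covariance_matrix M ?u = covariance_matrix M x + mat 1"
    unfolding covariance_indep_add[OF a(1) b(1) indep] covariance_cong_distr[OF a(1) x a(2)]
      covariance_cong_distr[OF b(1) w(1) b(2)] w(3) ..
  have "positive_definite (covariance_matrix M ?u)"
    unfolding positive_definite_def
  proof (intro conjI allI impI covariance_symmetric)
    fix v :: "real^'n" assume "v \<noteq> 0"
    then show "0 < v \<bullet> (covariance_matrix M ?u *v v)"
      using covariance_nonneg[OF x, of v]
      by (simp add: cov matrix_vector_mult_add_rdistrib inner_add_right add_nonneg_pos)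
  qed
  then have "S ?u = covariance_matrix M x + mat 1"
    using S_eq_covariance_if_positive_definite[OF V_add[OF a(1) b(1)]] cov by simp
  moreover have "S ?u = S x + mat 1"
    unfolding S_indep_add[OF a(1) b(1) indep] S_cong_distr[OF a(1) x a(2)] S_cong_distr[OF b(1) w(1) b(2)]
      S_gauss[OF w(1,2)] ..
  ultimately show ?thesis by simp
qed

end

theorem proposition1:
  fixes M :: "'a measure"
    and D :: "('a \<Rightarrow> real) set"
    and S :: "('a \<Rightarrow> real^'n) \<Rightarrow> real^'n^'n"
  assumes "prob_space M"
    and "square_integrable_class M D"
    and "contains_std_normal M D"
    and "closed_under_affine D"
    and "closed_under_addition (random_vectors D :: ('a \<Rightarrow> real^'n) set)"
    and "rich M (random_vectors D :: ('a \<Rightarrow> real^'n) set)"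
    and "S \<in> standardized_scatter_functionals M (random_vectors D)"
    and "normal_continuous M (random_vectors D) S"
    and "self_contained M (random_vectors D) S"
    and "additive_functional M (random_vectors D) S"
  shows "\<forall>x \<in> random_vectors D. S x = covariance_matrix M x"
proof -
  interpret scatter_problem M D S
    by (rule scatter_problem.intro[OF assms(1)], rule scatter_problem_axioms.intro) (fact assms)+
  show ?thesis
    using S_eq_covariance by blast
qed

end
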